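(* Let $\mathcal{F}\in C^\infty(\mathcal{P}_+(G))$, $\rho\in\mathcal{P}_+(G)$ and $\sigma_1,\sigma_2\in T_\rho\mathcal{P}_+(G)$. Then the Hessian of $\mathcal{F}$ in $(\mathcal{P}_+(G),g_W)$ is $$\begin{aligned}\mathrm{Hess}_W\mathcal{F}(\rho)(\sigma_1,\sigma_2)=\sigma_1^{\mathsf T}d^2_\rho\mathcal{F}(\rho)\sigma_2+\frac12\Big\{&d_\rho\mathcal{F}(\rho)^{\mathsf T}L(\sigma_1)L(\rho)^\dagger\sigma_2+d_\rho\mathcal{F}(\rho)^{\mathsf T}L(\sigma_2)L(\rho)^\dagger\sigma_1\\&-d_\rho\mathcal{F}(\rho)^{\mathsf T}L(\rho)\Big(\nabla_GL(\rho)^\dagger\sigma_1\circ\nabla_GL(\rho)^\dagger\sigma_2\Big)\Big\}.\end{aligned}$$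
   Context: $G=(V,E,\omega)$ is a connected, weighted, undirected finite graph with vertex set $V=\{1,\dots,n\}$, edge set $E$ and weights $\omega_{ij}=\omega_{ji}>0$ if $(i,j)\in E$, $\omega_{ij}=0$ otherwise; $N(i)=\{j:(i,j)\in E\}$. For $\Phi\in\mathbb{R}^n$, $\nabla_G\Phi=(\nabla_{ij}\Phi)$ with $\nabla_{ij}\Phi=\sqrt{\omega_{ij}}(\Phi(i)-\Phi(j))$; for edge fields $v,\tilde v$, $v\circ\tilde v=\frac12\big(\sum_{j\in N(i)}v_{ij}\tilde v_{ij}\big)_{i=1}^n\in\mathbb{R}^n$. For $a\in\mathbb{R}^n$ put $\theta_{ij}(a)=\frac{a_i+a_j}{2}$; the linear weighted Laplacian matrix $L(a)\in\mathbb{R}^{n\times n}$ is given by $(L(a)\Phi)(i)=\sum_{j\in N(i)}\omega_{ij}\theta_{ij}(a)(\Phi(i)-\Phi(j))$. $A^\dagger$ is the Moore-Penrose pseudo-inverse. $\mathcal{P}_+(G)=\{\rho\in\mathbb{R}^n:\sum_i\rho_i=1,\ \rho_i>0\}$, with tangent space $T_\rho\mathcal{P}_+(G)=\{\sigma\in\mathbb{R}^n:\sum_i\sigma_i=0\}$, carries the Riemannian metric $g_W(\sigma_1,\sigma_2)=\sigma_1^{\mathsf T}L(\rho)^\dagger\sigma_2$. The Hessian is the Riemannian one: $\mathrm{Hess}_W\mathcal{F}(\sigma_1,\sigma_2)=g_W(\sigma_1,\nabla^W_{\sigma_2}\nabla_W\mathcal{F})$, with $\nabla^W$ the Levi-Civita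 connection and $\nabla_W\mathcal{F}$ the gradient. $d_\rho\mathcal{F}=(\partial\mathcal{F}/\partial\rho_i)_{i=1}^n$ and $d^2_\rho\mathcal{F}=(\partial^2\mathcal{F}/\partial\rho_i\partial\rho_j)_{i,j=1}^n$ are Euclidean derivatives of a smooth extension of $\mathcal{F}$ to a neighborhood of $\mathcal{P}_+(G)$ in $\mathbb{R}^n$. *)

theory Defs
  imports "HOL-Analysis.Analysis"
begin

section \<open>Weighted graphs\<close>

text \<open>The vertex set is the finite type \<open>'n\<close>.\<close>

definition connected_weighted_graph :: "('n::finite \<times> 'n) set \<Rightarrow> ('n \<Rightarrow> 'n \<Rightarrow> real) \<Rightarrow> bool" where
  "connected_weighted_graph E \<omega> \<longleftrightarrow>
     sym E \<and>
     (\<forall>i j. \<omega> i j = \<omega> j i) \<and>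
     (\<forall>i j. (i, j) \<in> E \<longrightarrow> \<omega> i j > 0) \<and>
     (\<forall>i j. (i, j) \<notin> E \<longrightarrow> \<omega> i j = 0) \<and>
     (\<forall>i j. (i, j) \<in> E\<^sup>*)"

definition nbhd :: "('n::finite \<times> 'n) set \<Rightarrow> 'n \<Rightarrow> 'n set" where
  "nbhd E i = {j. (i, j) \<in> E}"

definition graph_grad :: "('n::finite \<Rightarrow> 'n \<Rightarrow> real) \<Rightarrow> real ^ 'n \<Rightarrow> 'n \<Rightarrow> 'n \<Rightarrow> real" where
  "graph_grad \<omega> \<Phi> i j = sqrt (\<omega> i j) * (\<Phi> $ i - \<Phi> $ j)"

definition edge_circ ::
    "('n::finite \<times> 'n) set \<Rightarrow> ('n \<Rightarrow> 'n \<Rightarrow> real) \<Rightarrow> ('n \<Rightarrow> 'n \<Rightarrow> real) \<Rightarrow> real ^ 'n" where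
  "edge_circ E v w = (\<chi> i. 1 / 2 * (\<Sum>j\<in>nbhd E i. v i j * w i j))"

definition \<theta> :: "real ^ 'n \<Rightarrow> 'n::finite \<Rightarrow> 'n \<Rightarrow> real" where
  "\<theta> a i j = (a $ i + a $ j) / 2"

definition Lap :: "('n::finite \<times> 'n) set \<Rightarrow> ('n \<Rightarrow> 'n \<Rightarrow> real) \<Rightarrow> real ^ 'n \<Rightarrow> real ^ 'n ^ 'n" where
  "Lap E \<omega> a =
     matrix (\<lambda>\<Phi>. \<chi> i. \<Sum>j\<in>nbhd E i. \<omega> i j * \<theta> a i j * (\<Phi> $ i - \<Phi> $ j))"

definition is_pinv :: "real ^ 'n ^ 'm \<Rightarrow> real ^ 'm ^ 'n \<Rightarrow> bool" where
  "is_pinv A B \<longleftrightarrow>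
     A ** B ** A = A \<and> B ** A ** B = B \<and>
     transpose (A ** B) = A ** B \<and> transpose (B ** A) = B ** A"

definition pinv :: "real ^ 'n ^ 'm \<Rightarrow> real ^ 'm ^ 'n" where
  "pinv A = (THE B. is_pinv A B)"

section \<open>Smooth functions\<close>

text \<open>\<open>Ck_on k f U\<close> is meant for open \<open>U\<close> in a finite-dimensional space: there, iterated directional
  derivatives that are again of this class characterise \<open>C\<^sup>k\<close> functions.\<close>

primrec Ck_on ::
    "nat \<Rightarrow> ('a::real_normed_vector \<Rightarrow> 'b::real_normed_vector) \<Rightarrow> 'a set \<Rightarrow> bool" where
  "Ck_on 0 f U \<longleftrightarrow> continuous_on U f"
| "Ck_on (Suc k) f U \<longleftrightarrow>
     (\<forall>x\<in>U. f differentiable at x) \<and>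
     (\<forall>v. Ck_on k (\<lambda>x. frechet_derivative f (at x) v) U)"

definition Cinf_on :: "('a::real_normed_vector \<Rightarrow> 'b::real_normed_vector) \<Rightarrow> 'a set \<Rightarrow> bool" where
  "Cinf_on f U \<longleftrightarrow> (\<forall>k. Ck_on k f U)"

definition dir_deriv ::
    "('a::real_normed_vector \<Rightarrow> 'b::real_normed_vector) \<Rightarrow> 'a \<Rightarrow> 'a \<Rightarrow> 'b" where
  "dir_deriv f x v = vector_derivative (\<lambda>t. f (x + t *\<^sub>R v)) (at (0::real))"

definition eucl_grad :: "(real ^ 'n \<Rightarrow> real) \<Rightarrow> real ^ 'n \<Rightarrow> real ^ 'n" where
  "eucl_grad f x = (\<chi> i. dir_deriv f x (axis i 1))"

definition eucl_hess :: "(real ^ 'n \<Rightarrow> real) \<Rightarrow> real ^ 'n \<Rightarrow> real ^ 'n ^ 'n" where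
  "eucl_hess f x = (\<chi> i j. dir_deriv (\<lambda>y. dir_deriv f y (axis j 1)) x (axis i 1))"

section \<open>The open probability simplex as a manifold\<close>

definition simplex_pos :: "(real ^ 'n::finite) set" where
  "simplex_pos = {\<rho>. (\<Sum>i\<in>UNIV. \<rho> $ i) = 1 \<and> (\<forall>i. \<rho> $ i > 0)}"

text \<open>The tangent space is the same at every point.\<close>

definition tangent :: "(real ^ 'n::finite) set" where
  "tangent = {\<sigma>. (\<Sum>i\<in>UNIV. \<sigma> $ i) = 0}"

text \<open>Objects living on the simplex (functions, vector fields, connections) are represented by total
  functions whose values off \<open>simplex_pos\<close> are irrelevant. Smoothness is that of an embedded
  submanifold, by local smooth extension. Since \<open>simplex_pos\<close> is relatively open in an affine
  hyperplane with direction \<open>tangent\<close>, \<open>dir_deriv f \<rho> v\<close> at \<open>\<rho> \<in> simplex_pos\<close> with \<open>v \<in> tangent\<close>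
  only depends on \<open>f\<close> on \<open>simplex_pos\<close>: it is the differential of \<open>f\<close> as a function on the
  manifold.\<close>

definition smooth_on_simplex :: "(real ^ 'n::finite \<Rightarrow> 'b::real_normed_vector) \<Rightarrow> bool" where
  "smooth_on_simplex f \<longleftrightarrow>
     (\<forall>\<rho>\<in>simplex_pos. \<exists>U h. open U \<and> \<rho> \<in> U \<and> Cinf_on h U \<and> (\<forall>x\<in>U \<inter> simplex_pos. h x = f x))"

definition vector_fields :: "(real ^ 'n::finite \<Rightarrow> real ^ 'n) set" where
  "vector_fields = {X. smooth_on_simplex X \<and> (\<forall>\<rho>\<in>simplex_pos. X \<rho> \<in> tangent)}"

section \<open>Levi-Civita connection, gradient and Hessian\<close>

type_synonym 'n metric = "real ^ 'n \<Rightarrow> real ^ 'n \<Rightarrow> real ^ 'n \<Rightarrow> real"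
type_synonym 'n field = "real ^ 'n \<Rightarrow> real ^ 'n"

text \<open>\<open>D X Y\<close> is the covariant derivative of \<open>Y\<close> in direction \<open>X\<close>. Linearity over the reals in \<open>Y\<close>
  follows from additivity and the Leibniz rule for constant \<open>f\<close>; that \<open>D X Y\<close> on \<open>simplex_pos\<close>
  only depends on \<open>X\<close> and \<open>Y\<close> on \<open>simplex_pos\<close> follows with \<open>f\<close> the indicator function of
  \<open>simplex_pos\<close>.\<close>

definition affine_connection :: "('n::finite field \<Rightarrow> 'n field \<Rightarrow> 'n field) \<Rightarrow> bool" where
  "affine_connection D \<longleftrightarrow>
     (\<forall>X\<in>vector_fields. \<forall>Y\<in>vector_fields. D X Y \<in> vector_fields) \<and>
     (\<forall>X\<in>vector_fields. \<forall>X'\<in>vector_fields. \<forall>Y\<in>vector_fields. \<forall>\<rho>\<in>simplex_pos.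
        D (\<lambda>x. X x + X' x) Y \<rho> = D X Y \<rho> + D X' Y \<rho>) \<and>
     (\<forall>f. smooth_on_simplex f \<longrightarrow> (\<forall>X\<in>vector_fields. \<forall>Y\<in>vector_fields. \<forall>\<rho>\<in>simplex_pos.
        D (\<lambda>x. f x *\<^sub>R X x) Y \<rho> = f \<rho> *\<^sub>R D X Y \<rho>)) \<and>
     (\<forall>X\<in>vector_fields. \<forall>Y\<in>vector_fields. \<forall>Y'\<in>vector_fields. \<forall>\<rho>\<in>simplex_pos.
        D X (\<lambda>x. Y x + Y' x) \<rho> = D X Y \<rho> + D X Y' \<rho>) \<and>
     (\<forall>f. smooth_on_simplex f \<longrightarrow> (\<forall>X\<in>vector_fields. \<forall>Y\<in>vector_fields. \<forall>\<rho>\<in>simplex_pos.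
        D X (\<lambda>x. f x *\<^sub>R Y x) \<rho> = dir_deriv f \<rho> (X \<rho>) *\<^sub>R Y \<rho> + f \<rho> *\<^sub>R D X Y \<rho>))"

definition lie_bracket :: "'n::finite field \<Rightarrow> 'n field \<Rightarrow> 'n field" where
  "lie_bracket X Y \<rho> = dir_deriv Y \<rho> (X \<rho>) - dir_deriv X \<rho> (Y \<rho>)"

definition torsion_free :: "('n::finite field \<Rightarrow> 'n field \<Rightarrow> 'n field) \<Rightarrow> bool" where
  "torsion_free D \<longleftrightarrow>
     (\<forall>X\<in>vector_fields. \<forall>Y\<in>vector_fields. \<forall>\<rho>\<in>simplex_pos.
        D X Y \<rho> - D Y X \<rho> = lie_bracket X Y \<rho>)"

definition metric_compatible ::
    "'n::finite metric \<Rightarrow> ('n field \<Rightarrow> 'n field \<Rightarrow> 'n field) \<Rightarrow> bool" where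
  "metric_compatible g D \<longleftrightarrow>
     (\<forall>X\<in>vector_fields. \<forall>Y\<in>vector_fields. \<forall>Z\<in>vector_fields. \<forall>\<rho>\<in>simplex_pos.
        dir_deriv (\<lambda>x. g x (Y x) (Z x)) \<rho> (X \<rho>) = g \<rho> (D X Y \<rho>) (Z \<rho>) + g \<rho> (Y \<rho>) (D X Z \<rho>))"

text \<open>The Levi-Civita connection is unique as far as the values of \<open>D X Y\<close> on \<open>simplex_pos\<close> for
  vector fields \<open>X\<close> and \<open>Y\<close> are concerned. The choice operator only fixes the irrelevant values of
  the total function.\<close>

definition levi_civita :: "'n::finite metric \<Rightarrow> 'n field \<Rightarrow> 'n field \<Rightarrow> 'n field" where
  "levi_civita g = (SOME D. affine_connection D \<and> torsion_free D \<and> metric_compatible g D)"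

definition riem_grad :: "'n::finite metric \<Rightarrow> (real ^ 'n \<Rightarrow> real) \<Rightarrow> 'n field" where
  "riem_grad g F \<rho> = (THE v. v \<in> tangent \<and> (\<forall>\<sigma>\<in>tangent. g \<rho> v \<sigma> = dir_deriv F \<rho> \<sigma>))"

text \<open>A covariant derivative at \<open>\<rho>\<close> only depends on the value at \<open>\<rho>\<close> of the field giving the
  direction, so the tangent vector \<open>\<sigma>\<^sub>2\<close> is extended to a constant vector field.\<close>

definition riem_hess ::
    "'n::finite metric \<Rightarrow> (real ^ 'n \<Rightarrow> real) \<Rightarrow> real ^ 'n \<Rightarrow> real ^ 'n \<Rightarrow> real ^ 'n \<Rightarrow> real" where
  "riem_hess g F \<rho> \<sigma>\<^sub>1 \<sigma>\<^sub>2 = g \<rho> \<sigma>\<^sub>1 (levi_civita g (\<lambda>_. \<sigma>\<^sub>2) (riem_grad g F) \<rho>)"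

definition g_W :: "('n::finite \<times> 'n) set \<Rightarrow> ('n \<Rightarrow> 'n \<Rightarrow> real) \<Rightarrow> 'n metric" where
  "g_W E \<omega> \<rho> \<sigma>\<^sub>1 \<sigma>\<^sub>2 = \<sigma>\<^sub>1 \<bullet> (pinv (Lap E \<omega> \<rho>) *v \<sigma>\<^sub>2)"

definition Hess_W ::
    "('n::finite \<times> 'n) set \<Rightarrow> ('n \<Rightarrow> 'n \<Rightarrow> real) \<Rightarrow> (real ^ 'n \<Rightarrow> real) \<Rightarrow>
     real ^ 'n \<Rightarrow> real ^ 'n \<Rightarrow> real ^ 'n \<Rightarrow> real" where
  "Hess_W E \<omega> = riem_hess (g_W E \<omega>)"

end

theory Submission
  imports Defs
begin

text \<open>
  The gradient of \<open>F\<close> for the metric \<open>g\<close> is \<open>L(\<rho>) dF\<close>, so \<open>g(\<sigma>, grad F)\<close> is the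
  derivative of \<open>F\<close> along \<open>\<sigma>\<close>. Let \<open>D\<close> be the Levi-Civita connection. Extend \<open>\<sigma>\<^sub>1\<close> and \<open>\<sigma>\<^sub>2\<close> to
  constant vector fields and differentiate \<open>g(\<sigma>\<^sub>1, grad F)\<close> along \<open>\<sigma>\<^sub>2\<close>. Metric compatibility turns the
  Euclidean second derivative of \<open>F\<close> into
  \<open>Hess F(\<sigma>\<^sub>1, \<sigma>\<^sub>2) + g(D\<^bsub>\<sigma>\<^sub>2\<^esub> \<sigma>\<^sub>1, grad F)\<close>. So only the covariant derivatives of constant
  fields have to be found. These fields commute, and the Koszul formula expresses
  \<open>2 g(D\<^bsub>a\<^esub> b, c)\<close> by the three derivatives of the metric along \<open>a\<close>, \<open>b\<close> and \<open>c\<close>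
  (\<open>koszul\<close>).

  With \<open>P = L(\<rho>)\<^sup>\<dagger>\<close>, the derivative of \<open>g(b, c)\<close> along \<open>a\<close> is \<open>- (P b) \<bullet> L(a) (P c)\<close>, from
  differentiating \<open>L(\<rho>) L(\<rho>)\<^sup>\<dagger> c = c\<close> (\<open>inner_dir_deriv_pinv\<close>). For \<open>c = grad F\<close> the vector \<open>P c\<close> is
  \<open>dF\<close> up to a constant vector, which \<open>L\<close> annihilates. Two of the three terms are therefore the
  first two in the braces, and the third one, with \<open>L(grad F)\<close> in the middle, becomes
  \<open>dF\<^sup>T L(\<rho>) (\<nabla>P\<sigma>\<^sub>1 \<circ> \<nabla>P\<sigma>\<^sub>2)\<close> by summation by parts on the graph (\<open>circ_inner\<close>).

  Since \<open>levi_civita\<close> is a choice among the torsion-free metric connections, one of them has to be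
  exhibited; it is the flat derivative corrected by the Christoffel symbols that the Koszul formula
  dictates. Showing that it maps smooth fields to smooth fields requires that sums, products,
  quotients and derivatives of smooth functions are smooth, and that the pseudo-inverse depends
  smoothly on \<open>\<rho>\<close>. The latter holds because \<open>L(\<rho>)\<^sup>\<dagger>\<close> is, up to the projection onto the
  constants, the inverse of an invertible matrix, with Cramer's rule for the inverse
  (\<open>smooth_linear_solve\<close>, \<open>smooth_pinv\<close>). Symmetry of second derivatives
  (\<open>mixed_derivatives_commute\<close>) identifies the iterated derivative with the Hessian matrix.
\<close>

section \<open>Calculus of smooth functions\<close>

lemma Ck_on_cong:
  assumes "open U" and "\<And>x. x \<in> U \<Longrightarrow> f x = g x" and "Ck_on k f U"
  shows "Ck_on k g U"
  using assms(2,3)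
proof (induction k arbitrary: f g)
  case 0
  then show ?case using continuous_on_cong by force
next
  case (Suc k)
  have der: "(g has_derivative frechet_derivative f (at x)) (at x)" if "x \<in> U" for x
    using Suc.prems that frechet_derivative_works has_derivative_transform_within_open[OF _ assms(1) that]
    by (metis Ck_on.simps(2))
  then have eq: "frechet_derivative f (at x) v = frechet_derivative g (at x) v" if "x \<in> U" for x v
    using that frechet_derivative_at by metis
  have "Ck_on k (\<lambda>x. frechet_derivative g (at x) v) U" for v
    by (rule Suc.IH[of "\<lambda>x. frechet_derivative f (at x) v", OF eq]) (use Suc.prems(2) in auto)
  moreover have "g differentiable at x" if "x \<in> U" for x
    using der[OF that] by (rule differentiableI)
  ultimately show ?case unfolding Ck_on.simps by blast
qed

lemma Cinf_on_cong:
  "open U \<Longrightarrow> (\<And>x. x \<in> U \<Longrightarrow> f x = g x) \<Longrightarrow> Cinf_on f U \<Longrightarrow> Cinf_on g U"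
  unfolding Cinf_on_def using Ck_on_cong by blast

lemma Ck_on_subset: "Ck_on k f U \<Longrightarrow> W \<subseteq> U \<Longrightarrow> Ck_on k f W"
  by (induction k arbitrary: f) (auto intro: continuous_on_subset)

lemma Cinf_on_subset: "Cinf_on f U \<Longrightarrow> W \<subseteq> U \<Longrightarrow> Cinf_on f W"
  unfolding Cinf_on_def using Ck_on_subset by blast

lemma Cinf_on_differentiable: "Cinf_on f U \<Longrightarrow> x \<in> U \<Longrightarrow> f differentiable at x"
  unfolding Cinf_on_def by (metis Ck_on.simps(2))

lemma Cinf_on_has_derivative:
  "Cinf_on f U \<Longrightarrow> x \<in> U \<Longrightarrow> (f has_derivative frechet_derivative f (at x)) (at x)"
  using Cinf_on_differentiable frechet_derivative_works by blast

lemma Cinf_on_derivative: "Cinf_on f U \<Longrightarrow> Cinf_on (\<lambda>x. frechet_derivative f (at x) v) U"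
  unfolding Cinf_on_def by (metis Ck_on.simps(2))

lemma Cinf_on_continuous: "Cinf_on f U \<Longrightarrow> continuous_on U f"
  unfolding Cinf_on_def by (metis Ck_on.simps(1))

text \<open>The closure properties below are inductions whose step is this rule: \<open>f'\<close> is the derivative
  that the differentiation rules give, which is the chosen \<open>frechet_derivative\<close> only on \<open>U\<close>.\<close>

lemma Ck_on_SucI:
  assumes "open U" and "\<And>x. x \<in> U \<Longrightarrow> (f has_derivative f' x) (at x)"
    and "\<And>v. Ck_on k (\<lambda>x. f' x v) U"
  shows "Ck_on (Suc k) f U"
proof -
  have "Ck_on k (\<lambda>x. frechet_derivative f (at x) v) U" for v
    using frechet_derivative_at[OF assms(2)] by (intro Ck_on_cong[OF assms(1) _ assms(3)[of v]]) auto
  moreover have "f differentiable at x" if "x \<in> U" for x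
    using assms(2)[OF that] by (rule differentiableI)
  ultimately show ?thesis by simp
qed

lemma Ck_on_const: "open U \<Longrightarrow> Ck_on k (\<lambda>x. c) U"
proof (induction k arbitrary: c)
  case (Suc k)
  show ?case by (rule Ck_on_SucI[where f' = "\<lambda>x v. 0"]) (use Suc in auto)
qed simp

lemma Cinf_on_const: "open U \<Longrightarrow> Cinf_on (\<lambda>x. c) U"
  unfolding Cinf_on_def using Ck_on_const by blast

lemma Ck_on_add:
  assumes "open U"
  shows "Ck_on k f U \<Longrightarrow> Ck_on k g U \<Longrightarrow> Ck_on k (\<lambda>x. f x + g x) U"
proof (induction k arbitrary: f g)
  case 0
  then show ?case by (auto intro: continuous_intros)
next
  case (Suc k)
  then show ?case
    by (intro Ck_on_SucI[OF assms, where f' = "\<lambda>x v. frechet_derivative f (at x) v + frechet_derivative g (at x) v"]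
        has_derivative_add) (auto simp: frechet_derivative_works[symmetric])
qed

lemma Cinf_on_add:
  "open U \<Longrightarrow> Cinf_on f U \<Longrightarrow> Cinf_on g U \<Longrightarrow> Cinf_on (\<lambda>x. f x + g x) U"
  unfolding Cinf_on_def using Ck_on_add by blast

lemma Cinf_on_sum:
  "open U \<Longrightarrow> (\<And>i. i \<in> I \<Longrightarrow> Cinf_on (f i) U) \<Longrightarrow> Cinf_on (\<lambda>x. \<Sum>i\<in>I. f i x) U"
proof (induction I rule: infinite_finite_induct)
  case (insert i I)
  then show ?case by (auto intro: Cinf_on_add)
qed (auto intro: Cinf_on_const)

lemma Cinf_on_bounded_linear:
  assumes "bounded_linear T" and "open U" and "Cinf_on f U"
  shows "Cinf_on (\<lambda>x. T (f x)) U"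
proof -
  have "Ck_on k (\<lambda>x. T (f x)) U" for k
    using assms(3)
  proof (induction k arbitrary: f)
    case 0
    show ?case
      using bounded_linear.continuous_on[OF assms(1) Cinf_on_continuous[OF 0]] by simp
  next
    case (Suc k)
    show ?case
      by (rule Ck_on_SucI[OF assms(2)], rule bounded_linear.has_derivative[OF assms(1)],
          rule Cinf_on_has_derivative[OF Suc.prems])
        (simp, rule Suc.IH[OF Cinf_on_derivative[OF Suc.prems]])
  qed
  then show ?thesis by (simp add: Cinf_on_def)
qed

text \<open>The product rule writes a derivative of \<open>B f g\<close> as a sum of two terms \<open>B f' g\<close> and \<open>B f g'\<close>
  with smooth factors, so an induction over the order of differentiability with \<open>f\<close> and \<open>g\<close>
  varying goes through.\<close>

lemma Cinf_on_bilinear: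
  assumes "bounded_bilinear B" and "open U" and "Cinf_on f U" and "Cinf_on g U"
  shows "Cinf_on (\<lambda>x. B (f x) (g x)) U"
proof -
  have "Ck_on k (\<lambda>x. B (f x) (g x)) U" for k
    using assms(3,4)
  proof (induction k arbitrary: f g)
    case 0
    show ?case
      using bounded_bilinear.continuous_on[OF assms(1) Cinf_on_continuous[OF 0(1)]
          Cinf_on_continuous[OF 0(2)]] by simp
  next
    case (Suc k)
    show ?case
    proof (rule Ck_on_SucI[OF assms(2)])
      fix x assume "x \<in> U"
      then show "((\<lambda>x. B (f x) (g x)) has_derivative
          (\<lambda>v. B (f x) (frechet_derivative g (at x) v) + B (frechet_derivative f (at x) v) (g x))) (at x)"
        by (intro bounded_bilinear.FDERIV[OF assms(1)] Cinf_on_has_derivative[OF Suc.prems(1)]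
            Cinf_on_has_derivative[OF Suc.prems(2)])
    next
      fix v
      show "Ck_on k (\<lambda>x. B (f x) (frechet_derivative g (at x) v) + B (frechet_derivative f (at x) v) (g x)) U"
        by (intro Ck_on_add assms(2) Suc Cinf_on_derivative)
    qed
  qed
  then show ?thesis by (simp add: Cinf_on_def)
qed

text \<open>The derivative of a quotient \<open>g / f ^ m\<close> is a sum of two quotients of the same form with
  new numerators and exponents. The induction therefore runs over all exponents \<open>m\<close> at once.\<close>

lemma Cinf_on_divide:
  fixes f g :: "'a::real_normed_vector \<Rightarrow> real"
  assumes "open U" and f: "Cinf_on f U" and nz: "\<And>x. x \<in> U \<Longrightarrow> f x \<noteq> 0" and "Cinf_on g U"
  shows "Cinf_on (\<lambda>x. g x / f x) U"
proof -
  note mult = Cinf_on_bilinear[OF bounded_bilinear_mult assms(1)]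
  have "Ck_on k (\<lambda>x. g x / f x ^ m) U" for k m
    using assms(4)
  proof (induction k arbitrary: g m)
    case 0
    then show ?case using Cinf_on_continuous f nz by (auto intro!: continuous_intros)
  next
    case (Suc k)
    let ?g' = "\<lambda>x. frechet_derivative g (at x)" and ?f' = "\<lambda>x. frechet_derivative f (at x)"
    show ?case
    proof (rule Ck_on_SucI[OF assms(1)])
      fix x assume x: "x \<in> U"
      show "((\<lambda>x. g x / f x ^ m) has_derivative
          (\<lambda>v. ?g' x v / f x ^ m + (- real m) * (g x * ?f' x v) / f x ^ Suc m)) (at x)"
        by (rule derivative_eq_intros Cinf_on_has_derivative[OF Suc.prems x]
            Cinf_on_has_derivative[OF f x] | rule refl)+
          (use nz[OF x] in \<open>auto simp: fun_eq_iff field_simps power_Suc[symmetric] split: nat_diff_split simp del: power_Suc\<close>,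
           simp)
    next
      fix v
      show "Ck_on k (\<lambda>x. ?g' x v / f x ^ m + (- real m) * (g x * ?f' x v) / f x ^ Suc m) U"
        by (intro Ck_on_add assms(1) Suc.IH mult Cinf_on_const Cinf_on_derivative f Suc.prems)
    qed
  qed
  from this[of _ 1] show ?thesis by (simp add: Cinf_on_def)
qed

lemma Cinf_on_id: "open U \<Longrightarrow> Cinf_on (\<lambda>x. x) U"
proof -
  assume U: "open U"
  have "Ck_on k (\<lambda>x. x) U" for k
  proof (cases k)
    case (Suc m)
    show ?thesis unfolding Suc
      by (rule Ck_on_SucI[OF U has_derivative_ident Ck_on_const[OF U]])
  qed simp
  then show ?thesis by (simp add: Cinf_on_def)
qed

lemma Cinf_on_derivative_field:
  fixes f :: "'a::euclidean_space \<Rightarrow> 'b::real_normed_vector"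
  assumes "open U" and f: "Cinf_on f U" and X: "Cinf_on X U"
  shows "Cinf_on (\<lambda>x. frechet_derivative f (at x) (X x)) U"
proof (rule Cinf_on_cong[OF assms(1)])
  show "Cinf_on (\<lambda>x. \<Sum>b\<in>Basis. (X x \<bullet> b) *\<^sub>R frechet_derivative f (at x) b) U"
    using assms by (intro Cinf_on_sum Cinf_on_bilinear[OF bounded_bilinear_scaleR] Cinf_on_derivative
        Cinf_on_bounded_linear[OF bounded_linear_inner_left])
  fix x assume "x \<in> U"
  then have lin: "linear (frechet_derivative f (at x))"
    using Cinf_on_differentiable[OF f] linear_frechet_derivative by blast
  show "(\<Sum>b\<in>Basis. (X x \<bullet> b) *\<^sub>R frechet_derivative f (at x) b) = frechet_derivative f (at x) (X x)"
    using arg_cong[OF euclidean_representation[of "X x"], of "frechet_derivative f (at x)"]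
    by (simp add: linear_sum[OF lin] linear_cmul[OF lin])
qed

text \<open>The mean value theorem is applied twice, first in the direction \<open>v\<close> to the increment in
  direction \<open>w\<close>, then in the direction \<open>w\<close> to the derivative along \<open>v\<close>.\<close>

lemma second_difference_mean_value:
  fixes f :: "'a::euclidean_space \<Rightarrow> real"
  assumes f: "Cinf_on f (ball x r)" and "0 < h" and small: "h * (norm v + norm w) < r"
  obtains p where "p \<in> ball x r"
    "f (x + h *\<^sub>R v + h *\<^sub>R w) - f (x + h *\<^sub>R v) - f (x + h *\<^sub>R w) + f x =
     h * (h * frechet_derivative (\<lambda>y. frechet_derivative f (at y) v) (at p) w)"
proof -
  have ball: "x + s *\<^sub>R v + t *\<^sub>R w \<in> ball x r" if "0 \<le> s" "s \<le> h" "0 \<le> t" "t \<le> h" for s t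
  proof -
    have "norm (s *\<^sub>R v + t *\<^sub>R w) \<le> s * norm v + t * norm w"
      using norm_triangle_ineq[of "s *\<^sub>R v" "t *\<^sub>R w"] that by simp
    also have "\<dots> \<le> h * norm v + h * norm w"
      using that by (intro add_mono mult_right_mono) auto
    finally show ?thesis using small by (simp add: dist_norm algebra_simps norm_minus_commute)
  qed
  define f1 where "f1 y = frechet_derivative f (at y) v" for y
  have f1: "Cinf_on f1 (ball x r)" unfolding f1_def by (rule Cinf_on_derivative[OF f])
  have along: "((\<lambda>s. g (a + s *\<^sub>R u)) has_real_derivative frechet_derivative g (at (a + s *\<^sub>R u)) u) (at s)"
    if "Cinf_on g (ball x r)" and "a + s *\<^sub>R u \<in> ball x r" for g :: "'a \<Rightarrow> real" and a u s
  proof -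
    note d = Cinf_on_has_derivative[OF that]
    have "((\<lambda>s. g (a + s *\<^sub>R u)) has_derivative (\<lambda>t. frechet_derivative g (at (a + s *\<^sub>R u)) (t *\<^sub>R u))) (at s)"
      by (rule has_derivative_compose[of "\<lambda>s. a + s *\<^sub>R u" "\<lambda>t. t *\<^sub>R u", OF _ d])
        (auto intro!: derivative_eq_intros)
    then show ?thesis
      using linear_cmul[OF has_derivative_linear[OF d]]
      by (simp add: has_field_derivative_def mult.commute[of "frechet_derivative _ _ _"] mult_commute_abs)
  qed
  have "\<exists>s. 0 < s \<and> s < h \<and>
      (f ((x + h *\<^sub>R w) + h *\<^sub>R v) - f (x + h *\<^sub>R v)) - (f ((x + h *\<^sub>R w) + 0 *\<^sub>R v) - f (x + 0 *\<^sub>R v))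
      = (h - 0) * (f1 ((x + h *\<^sub>R w) + s *\<^sub>R v) - f1 (x + s *\<^sub>R v))"
    unfolding f1_def
  proof (rule MVT2[OF \<open>0 < h\<close>])
    fix s assume s: "0 \<le> s" "s \<le> h"
    show "((\<lambda>s. f ((x + h *\<^sub>R w) + s *\<^sub>R v) - f (x + s *\<^sub>R v)) has_real_derivative
        frechet_derivative f (at ((x + h *\<^sub>R w) + s *\<^sub>R v)) v - frechet_derivative f (at (x + s *\<^sub>R v)) v) (at s)"
      using ball[OF s, of h] ball[OF s, of 0] \<open>0 < h\<close>
      by (intro DERIV_diff along f) (auto simp: algebra_simps)
  qed
  then obtain s where s: "0 < s" "s < h" and
    eq1: "f (x + h *\<^sub>R v + h *\<^sub>R w) - f (x + h *\<^sub>R v) - f (x + h *\<^sub>R w) + f x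
      = h * (f1 ((x + s *\<^sub>R v) + h *\<^sub>R w) - f1 ((x + s *\<^sub>R v) + 0 *\<^sub>R w))"
    by (auto simp: algebra_simps)
  have "\<exists>t. 0 < t \<and> t < h \<and> f1 ((x + s *\<^sub>R v) + h *\<^sub>R w) - f1 ((x + s *\<^sub>R v) + 0 *\<^sub>R w)
      = (h - 0) * frechet_derivative f1 (at ((x + s *\<^sub>R v) + t *\<^sub>R w)) w"
    using ball s by (intro MVT2[OF \<open>0 < h\<close>] along f1) auto
  then obtain t where t: "0 < t" "t < h" and
    eq2: "f1 ((x + s *\<^sub>R v) + h *\<^sub>R w) - f1 ((x + s *\<^sub>R v) + 0 *\<^sub>R w)
      = h * frechet_derivative f1 (at (x + s *\<^sub>R v + t *\<^sub>R w)) w" by auto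
  show thesis
    using that[OF ball[of s t]] s t eq1 eq2 unfolding f1_def by auto
qed

text \<open>The second difference is symmetric in \<open>v\<close> and \<open>w\<close>. If the mixed derivatives differed at \<open>x\<close>, they would
  by continuity still be separated on a small ball; but the mean value theorem in both orders
  expresses the same second difference by either of them, at two points of that ball.\<close>

lemma mixed_derivatives_commute:
  fixes f :: "'a::euclidean_space \<Rightarrow> real"
  assumes "open U" and "x \<in> U" and f: "Cinf_on f U"
  shows "frechet_derivative (\<lambda>y. frechet_derivative f (at y) v) (at x) w =
         frechet_derivative (\<lambda>y. frechet_derivative f (at y) w) (at x) v"
proof (rule ccontr)
  define A where "A = (\<lambda>p. frechet_derivative (\<lambda>y. frechet_derivative f (at y) v) (at p) w)"
  define B where "B = (\<lambda>p. frechet_derivative (\<lambda>y. frechet_derivative f (at y) w) (at p) v)"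
  assume "\<not> ?thesis"
  then have neq: "A x - B x \<noteq> 0" by (simp add: A_def B_def)
  have "continuous_on U (\<lambda>z. A z)" "continuous_on U (\<lambda>z. B z)"
    unfolding A_def B_def by (intro Cinf_on_continuous Cinf_on_derivative f)+
  then have "isCont A x" "isCont B x"
    using assms(1,2) continuous_on_eq_continuous_at by blast+
  define e where "e = \<bar>A x - B x\<bar> / 2"
  have "e > 0" using neq by (simp add: e_def)
  obtain d1 where d1: "d1 > 0" "\<And>p. dist p x < d1 \<Longrightarrow> dist (A p) (A x) < e"
    using \<open>isCont A x\<close> \<open>e > 0\<close> unfolding continuous_at_eps_delta by blast
  obtain d2 where d2: "d2 > 0" "\<And>p. dist p x < d2 \<Longrightarrow> dist (B p) (B x) < e"
    using \<open>isCont B x\<close> \<open>e > 0\<close> unfolding continuous_at_eps_delta by blast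
  obtain d3 where d3: "d3 > 0" "ball x d3 \<subseteq> U"
    using assms(1,2) openE by blast
  define r where "r = min d1 (min d2 d3)"
  have r: "r > 0" "ball x r \<subseteq> U" using d1 d2 d3 by (auto simp: r_def)
  have fr: "Cinf_on f (ball x r)" using Cinf_on_subset[OF f r(2)] .
  \<comment> \<open>The summand 1 keeps the denominator positive when both directions vanish.\<close>
  define h where "h = r / (2 * (norm v + norm w + 1))"
  have "norm v + norm w + 1 > 0" using norm_ge_zero[of v] norm_ge_zero[of w] by linarith
  then have h: "h > 0" and "h * (norm v + norm w + 1) = r / 2"
    using r by (auto simp: h_def divide_simps)
  then have small: "h * (norm v + norm w) < r"
    using r by (simp add: algebra_simps)
  obtain p where p: "p \<in> ball x r" "f (x + h *\<^sub>R v + h *\<^sub>R w) - f (x + h *\<^sub>R v) - f (x + h *\<^sub>R w) + f x = h * (h * A p)"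
    using second_difference_mean_value[OF fr h small] unfolding A_def by blast
  have small': "h * (norm w + norm v) < r" using small by (simp add: add.commute)
  obtain q where q: "q \<in> ball x r" "f (x + h *\<^sub>R w + h *\<^sub>R v) - f (x + h *\<^sub>R w) - f (x + h *\<^sub>R v) + f x = h * (h * B q)"
    using second_difference_mean_value[OF fr h small'] unfolding B_def by blast
  have "h * (h * A p) = h * (h * B q)"
    using p(2) q(2) by (simp add: algebra_simps)
  then have "A p = B q" using h by simp
  moreover have "dist (A p) (A x) < e" using d1(2) p(1) by (auto simp: r_def dist_commute)
  moreover have "dist (B q) (B x) < e" using d2(2) q(1) by (auto simp: r_def dist_commute)
  ultimately show False unfolding e_def dist_real_def by (simp add: abs_if split: if_splits)
qed

section \<open>Differentiation on the open simplex\<close>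

text \<open>A function on the simplex agrees with its local smooth extension along every short segment in a
  tangent direction, so its derivatives in tangent directions are those of the extension. This
  transfers the calculus of smooth functions on open sets to \<open>smooth_on_simplex\<close>.\<close>

lemma tangent_lines_stay_in_simplex:
  assumes "\<rho> \<in> simplex_pos" and "v \<in> tangent" and "open U" and "\<rho> \<in> U"
  obtains T :: "real set" where "open T" "0 \<in> T" "\<forall>t\<in>T. \<rho> + t *\<^sub>R v \<in> U \<inter> simplex_pos"
proof
  define S where "S = (\<Inter>i. {x :: real ^ 'a. 0 < x $ i})"
  have "open S" unfolding S_def
    by (intro open_INT) (auto intro: open_halfspace_component_gt_cart)
  moreover have "continuous_on UNIV (\<lambda>t. \<rho> + t *\<^sub>R v)"
    by (intro continuous_intros)
  ultimately show "open ((\<lambda>t. \<rho> + t *\<^sub>R v) -` (U \<inter> S))"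
    using assms(3) by (intro open_vimage) auto
  show "0 \<in> (\<lambda>t. \<rho> + t *\<^sub>R v) -` (U \<inter> S)"
    using assms by (auto simp: S_def simplex_pos_def)
  show "\<forall>t\<in>(\<lambda>t. \<rho> + t *\<^sub>R v) -` (U \<inter> S). \<rho> + t *\<^sub>R v \<in> U \<inter> simplex_pos"
    using assms(1,2)
    by (auto simp: S_def simplex_pos_def tangent_def sum.distrib sum_distrib_left[symmetric])
qed

lemma has_vector_derivative_along_line:
  assumes "h differentiable at x"
  shows "((\<lambda>t. h (x + t *\<^sub>R v)) has_vector_derivative frechet_derivative h (at x) v) (at 0)"
proof -
  have d: "(h has_derivative frechet_derivative h (at x)) (at x)"
    using assms frechet_derivative_works by blast
  have "((\<lambda>t. h (x + t *\<^sub>R v)) has_derivative (\<lambda>t. frechet_derivative h (at x) (t *\<^sub>R v))) (at 0)"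
    by (rule has_derivative_compose[of "\<lambda>t. x + t *\<^sub>R v" "\<lambda>t. t *\<^sub>R v"])
      (auto intro!: derivative_eq_intros simp: d)
  then show ?thesis
    by (simp add: has_vector_derivative_def linear_cmul[OF has_derivative_linear[OF d]])
qed

lemma dir_deriv_eq_frechet:
  "h differentiable at x \<Longrightarrow> dir_deriv h x v = frechet_derivative h (at x) v"
  unfolding dir_deriv_def by (rule vector_derivative_at) (rule has_vector_derivative_along_line)

lemma dir_derivI:
  "((\<lambda>t. f (x + t *\<^sub>R v)) has_vector_derivative d) (at 0) \<Longrightarrow> dir_deriv f x v = d"
  unfolding dir_deriv_def by (rule vector_derivative_at)

lemma has_vector_derivative_of_extension:
  assumes "open U" "x \<in> U" "h differentiable at x" "\<forall>y\<in>U \<inter> simplex_pos. h y = f y"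
    and "x \<in> simplex_pos" and "v \<in> tangent"
  shows "((\<lambda>t. f (x + t *\<^sub>R v)) has_vector_derivative frechet_derivative h (at x) v) (at 0)"
proof -
  obtain T where T: "open T" "0 \<in> T" "\<forall>t\<in>T. x + t *\<^sub>R v \<in> U \<inter> simplex_pos"
    by (rule tangent_lines_stay_in_simplex[OF assms(5,6,1,2)])
  show ?thesis
    by (rule has_vector_derivative_transform_within_open
        [OF has_vector_derivative_along_line[OF assms(3)] T(1,2)]) (use T(3) assms(4) in auto)
qed

lemma has_vector_derivative_simplex_cong:
  assumes "\<And>y. y \<in> simplex_pos \<Longrightarrow> f y = g y" and "x \<in> simplex_pos" and "v \<in> tangent"
    and "((\<lambda>t. f (x + t *\<^sub>R v)) has_vector_derivative d) (at 0)"
  shows "((\<lambda>t. g (x + t *\<^sub>R v)) has_vector_derivative d) (at 0)"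
proof -
  obtain T where T: "open T" "0 \<in> T" "\<forall>t\<in>T. x + t *\<^sub>R v \<in> UNIV \<inter> simplex_pos"
    by (rule tangent_lines_stay_in_simplex[OF assms(2,3) open_UNIV UNIV_I])
  show ?thesis
    by (rule has_vector_derivative_transform_within_open[OF assms(4) T(1,2)])
      (rule assms(1), use T(3) in auto)
qed

lemma smooth_on_simplexE:
  assumes "smooth_on_simplex f" and "x \<in> simplex_pos"
  obtains U h where "open U" "x \<in> U" "Cinf_on h U" "\<forall>y\<in>U \<inter> simplex_pos. h y = f y"
proof -
  from assms have "\<exists>U h. open U \<and> x \<in> U \<and> Cinf_on h U \<and> (\<forall>y\<in>U \<inter> simplex_pos. h y = f y)"
    by (simp add: smooth_on_simplex_def)
  then show thesis
    by (elim exE conjE) (rule that)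
qed

lemma smooth_on_simplexI:
  assumes "\<And>x. x \<in> simplex_pos \<Longrightarrow>
    \<exists>U h. open U \<and> x \<in> U \<and> Cinf_on h U \<and> (\<forall>y\<in>U \<inter> simplex_pos. h y = f y)"
  shows "smooth_on_simplex f"
  using assms unfolding smooth_on_simplex_def by blast

lemma smooth_derivative_linear:
  assumes "smooth_on_simplex f" and x: "x \<in> simplex_pos"
  obtains d where "linear d" "\<forall>v\<in>tangent.
    ((\<lambda>t. f (x + t *\<^sub>R v)) has_vector_derivative d v) (at 0)"
proof -
  obtain U h where U: "open U" "x \<in> U" "Cinf_on h U" "\<forall>y\<in>U \<inter> simplex_pos. h y = f y"
    by (rule smooth_on_simplexE[OF assms(1) x])
  note diff = Cinf_on_differentiable[OF U(3,2)]
  show thesis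
    by (rule that[of "frechet_derivative h (at x)"])
      (use has_vector_derivative_of_extension[OF U(1,2) diff U(4) x] linear_frechet_derivative[OF diff]
        in auto)
qed

lemma smooth_has_dir_deriv:
  assumes "smooth_on_simplex f" and "x \<in> simplex_pos" and "v \<in> tangent"
  shows "((\<lambda>t. f (x + t *\<^sub>R v)) has_vector_derivative dir_deriv f x v) (at 0)"
proof -
  obtain d where "linear d" and d: "\<forall>v\<in>tangent. ((\<lambda>t. f (x + t *\<^sub>R v)) has_vector_derivative d v) (at 0)"
    by (rule smooth_derivative_linear[OF assms(1,2)])
  from bspec[OF d assms(3)] show ?thesis by (simp only: dir_derivI[OF bspec[OF d assms(3)]])
qed

lemma add_tangent: "u \<in> tangent \<Longrightarrow> v \<in> tangent \<Longrightarrow> u + v \<in> tangent"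
  by (simp add: tangent_def sum.distrib)
lemma diff_tangent: "u \<in> tangent \<Longrightarrow> v \<in> tangent \<Longrightarrow> u - v \<in> tangent"
  by (simp add: tangent_def sum_subtractf)
lemma scaleR_tangent: "u \<in> tangent \<Longrightarrow> c *\<^sub>R u \<in> tangent"
  by (simp add: tangent_def sum_distrib_left[symmetric])

lemma dir_deriv_add_direction:
  assumes "smooth_on_simplex f" "x \<in> simplex_pos" "u \<in> tangent" "v \<in> tangent"
  shows "dir_deriv f x (u + v) = dir_deriv f x u + dir_deriv f x v"
proof -
  obtain d where lin: "linear d" and d: "\<forall>v\<in>tangent.
    ((\<lambda>t. f (x + t *\<^sub>R v)) has_vector_derivative d v) (at 0)"
    by (rule smooth_derivative_linear[OF assms(1,2)])
  have "dir_deriv f x w = d w" if "w \<in> tangent" for w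
    by (rule dir_derivI[OF bspec[OF d that]])
  then show ?thesis
    using assms by (simp add: add_tangent linear_add[OF lin])
qed

lemma dir_deriv_scaleR_direction:
  assumes "smooth_on_simplex f" "x \<in> simplex_pos" "u \<in> tangent"
  shows "dir_deriv f x (c *\<^sub>R u) = c *\<^sub>R dir_deriv f x u"
proof -
  obtain d where lin: "linear d" and d: "\<forall>v\<in>tangent.
    ((\<lambda>t. f (x + t *\<^sub>R v)) has_vector_derivative d v) (at 0)"
    by (rule smooth_derivative_linear[OF assms(1,2)])
  have "dir_deriv f x w = d w" if "w \<in> tangent" for w
    by (rule dir_derivI[OF bspec[OF d that]])
  then show ?thesis
    using assms by (simp add: scaleR_tangent linear_cmul[OF lin])
qed

lemma smooth_cong:
  "(\<And>x. x \<in> simplex_pos \<Longrightarrow> f x = g x) \<Longrightarrow> smooth_on_simplex f \<Longrightarrow> smooth_on_simplex g"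
  unfolding smooth_on_simplex_def by fastforce

lemma Cinf_on_smooth:
  assumes "open U" and "simplex_pos \<subseteq> U" and "Cinf_on h U"
  shows "smooth_on_simplex h"
  using assms by (intro smooth_on_simplexI) blast

lemma smooth_const: "smooth_on_simplex (\<lambda>x. c)"
  by (rule Cinf_on_smooth[of UNIV]) (auto intro: Cinf_on_const)

lemma smooth_ident: "smooth_on_simplex (\<lambda>x. x)"
  by (rule Cinf_on_smooth[of UNIV]) (auto intro: Cinf_on_id)

lemma smooth_bounded_linear:
  fixes f :: "real ^ 'n::finite \<Rightarrow> 'b::real_normed_vector" and T :: "'b \<Rightarrow> 'c::real_normed_vector"
  assumes "bounded_linear T" and "smooth_on_simplex f"
  shows "smooth_on_simplex (\<lambda>x. T (f x))"
proof (rule smooth_on_simplexI)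
  fix x :: "real ^ 'n" assume x: "x \<in> simplex_pos"
  obtain U h where "open U" "x \<in> U" "Cinf_on h U" "\<forall>y\<in>U \<inter> simplex_pos. h y = f y"
    by (rule smooth_on_simplexE[OF assms(2) x])
  then show "\<exists>U h. open U \<and> x \<in> U \<and> Cinf_on h U \<and> (\<forall>y\<in>U \<inter> simplex_pos. h y = T (f y))"
    using Cinf_on_bounded_linear[OF assms(1)]
    by (intro exI[of _ U] exI[of _ "\<lambda>x. T (h x)"]) auto
qed

lemma smooth_combine:
  fixes f :: "real ^ 'n::finite \<Rightarrow> 'b::real_normed_vector" and g :: "real ^ 'n \<Rightarrow> 'c::real_normed_vector"
  assumes "smooth_on_simplex f" and "smooth_on_simplex g"
    and "\<And>(U :: (real ^ 'n) set) h k. open U \<Longrightarrow> Cinf_on h U \<Longrightarrow> Cinf_on k U \<Longrightarrow> Cinf_on (\<lambda>x. B (h x) (k x)) U"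
  shows "smooth_on_simplex (\<lambda>x. B (f x) (g x))"
proof (rule smooth_on_simplexI)
  fix x :: "real ^ 'n" assume x: "x \<in> simplex_pos"
  obtain U h where U: "open U" "x \<in> U" "Cinf_on h U" "\<forall>y\<in>U \<inter> simplex_pos. h y = f y"
    by (rule smooth_on_simplexE[OF assms(1) x])
  obtain V k where V: "open V" "x \<in> V" "Cinf_on k V" "\<forall>y\<in>V \<inter> simplex_pos. k y = g y"
    by (rule smooth_on_simplexE[OF assms(2) x])
  have "Cinf_on (\<lambda>x. B (h x) (k x)) (U \<inter> V)"
    by (intro assms(3) open_Int U(1) V(1) Cinf_on_subset[OF U(3)] Cinf_on_subset[OF V(3)]) auto
  then show "\<exists>U h. open U \<and> x \<in> U \<and> Cinf_on h U \<and> (\<forall>y\<in>U \<inter> simplex_pos. h y = B (f y) (g y))"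
    using U V by (intro exI[of _ "U \<inter> V"] exI[of _ "\<lambda>x. B (h x) (k x)"]) auto
qed

lemma smooth_add:
  "smooth_on_simplex f \<Longrightarrow> smooth_on_simplex g \<Longrightarrow> smooth_on_simplex (\<lambda>x. f x + g x)"
  by (rule smooth_combine) (auto intro: Cinf_on_add)

lemma smooth_bilinear:
  "bounded_bilinear B \<Longrightarrow> smooth_on_simplex f \<Longrightarrow> smooth_on_simplex g \<Longrightarrow>
   smooth_on_simplex (\<lambda>x. B (f x) (g x))"
  by (rule smooth_combine) (auto intro: Cinf_on_bilinear)

lemmas smooth_mult = smooth_bilinear[OF bounded_bilinear_mult]
lemmas smooth_scaleR = smooth_bilinear[OF bounded_bilinear_scaleR]

lemma smooth_diff:
  "smooth_on_simplex f \<Longrightarrow> smooth_on_simplex g \<Longrightarrow> smooth_on_simplex (\<lambda>x. f x - g x)"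
  using smooth_add[of f "\<lambda>x. - g x"] smooth_bounded_linear[OF bounded_linear_minus[OF bounded_linear_ident]]
  by auto

lemma smooth_sum:
  "(\<And>i. i \<in> I \<Longrightarrow> smooth_on_simplex (f i)) \<Longrightarrow> smooth_on_simplex (\<lambda>x. \<Sum>i\<in>I. f i x)"
proof (induction I rule: infinite_finite_induct)
  case (insert i I)
  then show ?case by (auto intro: smooth_add)
qed (auto intro: smooth_const)

lemma smooth_prod:
  fixes f :: "'i \<Rightarrow> real ^ 'n::finite \<Rightarrow> real"
  shows "(\<And>i. i \<in> I \<Longrightarrow> smooth_on_simplex (f i)) \<Longrightarrow> smooth_on_simplex (\<lambda>x. \<Prod>i\<in>I. f i x)"
proof (induction I rule: infinite_finite_induct)
  case (insert i I)
  then show ?case by (auto intro: smooth_mult)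
qed (auto intro: smooth_const)

lemma smooth_divide:
  fixes f g :: "real ^ 'n::finite \<Rightarrow> real"
  assumes "smooth_on_simplex f" and g: "smooth_on_simplex g" and nz: "\<And>x. x \<in> simplex_pos \<Longrightarrow> g x \<noteq> 0"
  shows "smooth_on_simplex (\<lambda>x. f x / g x)"
proof -
  have "smooth_on_simplex (\<lambda>x. 1 / g x)"
  proof (rule smooth_on_simplexI)
    fix x :: "real ^ 'n" assume x: "x \<in> simplex_pos"
    obtain U h where U: "open U" "x \<in> U" "Cinf_on h U" "\<forall>y\<in>U \<inter> simplex_pos. h y = g y"
      by (rule smooth_on_simplexE[OF g x])
    let ?V = "U \<inter> h -` (- {0})"
    have V: "open ?V"
      by (intro continuous_open_preimage Cinf_on_continuous U open_Compl closed_singleton)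
    have "x \<in> ?V" using U(2,4) nz x by auto
    moreover have "Cinf_on (\<lambda>y. 1 / h y) ?V"
      by (intro Cinf_on_divide V Cinf_on_subset[OF U(3)] Cinf_on_const) auto
    ultimately show "\<exists>U h. open U \<and> x \<in> U \<and> Cinf_on h U \<and> (\<forall>y\<in>U \<inter> simplex_pos. h y = 1 / g y)"
      using U(4) V by (intro exI[of _ ?V] exI[of _ "\<lambda>y. 1 / h y"]) auto
  qed
  from smooth_mult[OF assms(1) this] show ?thesis by simp
qed

lemma smooth_component:
  fixes f :: "real ^ 'n::finite \<Rightarrow> 'b::real_normed_vector ^ 'm::finite"
  shows "smooth_on_simplex f \<Longrightarrow> smooth_on_simplex (\<lambda>x. f x $ i)"
  by (rule smooth_bounded_linear[OF bounded_linear_vec_nth])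

lemma smooth_vec:
  fixes f :: "real ^ 'n::finite \<Rightarrow> 'b::euclidean_space ^ 'm::finite"
  assumes "\<And>i. smooth_on_simplex (\<lambda>x. f x $ i)"
  shows "smooth_on_simplex f"
proof (rule smooth_cong)
  have "linear (axis i :: 'b \<Rightarrow> 'b ^ 'm)" for i
    by (rule linearI) (auto simp: axis_def vec_eq_iff)
  then have axis: "bounded_linear (axis i :: 'b \<Rightarrow> 'b ^ 'm)" for i
    by (simp add: linear_conv_bounded_linear)
  show "smooth_on_simplex (\<lambda>x. \<Sum>i\<in>UNIV. axis i (f x $ i))"
    by (rule smooth_sum) (rule smooth_bounded_linear[OF axis assms])
  have "(\<Sum>i\<in>UNIV. axis i (f x $ i)) $ k = (\<Sum>i\<in>UNIV. if k = i then f x $ i else 0)" for x k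
    by (auto simp: axis_def intro!: sum.cong)
  then show "(\<Sum>i\<in>UNIV. axis i (f x $ i)) = f x" for x
    by (simp add: vec_eq_iff)
qed

lemma bounded_bilinear_matrix_vector_mult:
  "bounded_bilinear (\<lambda>(A :: real ^ 'n::finite ^ 'm::finite) x. A *v x)"
  unfolding bilinear_conv_bounded_bilinear[symmetric] bilinear_def
  by (auto intro!: linearI simp: matrix_vector_mult_add_rdistrib matrix_vector_right_distrib
      scaleR_matrix_vector_assoc[symmetric] matrix_vector_mult_scaleR)

lemmas smooth_matrix_vector_mult = smooth_bilinear[OF bounded_bilinear_matrix_vector_mult]

lemma smooth_det:
  fixes A :: "real ^ 'n::finite \<Rightarrow> real ^ 'm::finite ^ 'm"
  assumes "\<And>i j. smooth_on_simplex (\<lambda>x. A x $ i $ j)"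
  shows "smooth_on_simplex (\<lambda>x. det (A x))"
  unfolding det_def by (intro smooth_sum smooth_mult smooth_const smooth_prod assms)

text \<open>By Cramer's rule, the solution is a quotient of determinants, which are polynomials in the
  entries. This is how the pseudo-inverse of the Laplacian is shown to be smooth.\<close>

lemma smooth_linear_solve:
  fixes A :: "real ^ 'n::finite \<Rightarrow> real ^ 'm::finite ^ 'm"
  assumes A: "smooth_on_simplex A" and b: "smooth_on_simplex b"
    and nz: "\<And>x. x \<in> simplex_pos \<Longrightarrow> det (A x) \<noteq> 0"
    and sol: "\<And>x. x \<in> simplex_pos \<Longrightarrow> A x *v u x = b x"
  shows "smooth_on_simplex u"
proof (rule smooth_vec)
  fix k
  have entry: "smooth_on_simplex (\<lambda>x. A x $ i $ j)" for i j
    by (intro smooth_component A)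
  show "smooth_on_simplex (\<lambda>x. u x $ k)"
  proof (rule smooth_cong)
    show "smooth_on_simplex (\<lambda>x. det (\<chi> i j. if j = k then b x $ i else A x $ i $ j) / det (A x))"
    proof (intro smooth_divide smooth_det nz entry)
      show "smooth_on_simplex (\<lambda>x. (\<chi> i j. if j = k then b x $ i else A x $ i $ j) $ i $ j)" for i j
        by (cases "j = k") (simp_all add: entry smooth_component[OF b])
    qed
    show "det (\<chi> i j. if j = k then b x $ i else A x $ i $ j) / det (A x) = u x $ k"
      if "x \<in> simplex_pos" for x
      using cramer[OF nz[OF that], THEN iffD1, OF sol[OF that]] by (metis (no_types, lifting) vec_lambda_beta)
  qed
qed

lemma smooth_dir_deriv_field:
  assumes f: "smooth_on_simplex f" and X: "X \<in> vector_fields"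
  shows "smooth_on_simplex (\<lambda>x. dir_deriv f x (X x))"
proof (rule smooth_on_simplexI)
  fix x :: "real ^ 'a" assume x: "x \<in> simplex_pos"
  have X': "smooth_on_simplex X" "\<And>y. y \<in> simplex_pos \<Longrightarrow> X y \<in> tangent"
    using X by (auto simp: vector_fields_def)
  obtain U h where U: "open U" "x \<in> U" "Cinf_on h U" "\<forall>y\<in>U \<inter> simplex_pos. h y = f y"
    by (rule smooth_on_simplexE[OF f x])
  obtain V k where V: "open V" "x \<in> V" "Cinf_on k V" "\<forall>y\<in>V \<inter> simplex_pos. k y = X y"
    by (rule smooth_on_simplexE[OF X'(1) x])
  have "Cinf_on (\<lambda>y. frechet_derivative h (at y) (k y)) (U \<inter> V)"
    by (intro Cinf_on_derivative_field Cinf_on_subset[OF U(3)] Cinf_on_subset[OF V(3)] open_Int U(1) V(1)) auto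
  moreover have "frechet_derivative h (at y) (k y) = dir_deriv f y (X y)"
    if y: "y \<in> U \<inter> V \<inter> simplex_pos" for y
    using dir_derivI[OF has_vector_derivative_of_extension[OF U(1) _ Cinf_on_differentiable[OF U(3)] U(4)]]
      X'(2) V(4) y by auto
  ultimately show "\<exists>U h. open U \<and> x \<in> U \<and> Cinf_on h U \<and> (\<forall>y\<in>U \<inter> simplex_pos. h y = dir_deriv f y (X y))"
    using U V by (intro exI[of _ "U \<inter> V"] exI[of _ "\<lambda>y. frechet_derivative h (at y) (k y)"]) auto
qed

text \<open>Differentiate the identity that the components of \<open>Y\<close> sum to zero along the simplex.\<close>

lemma dir_deriv_tangent:
  assumes Y: "Y \<in> vector_fields" and x: "x \<in> simplex_pos" and v: "v \<in> tangent"
  shows "dir_deriv Y x v \<in> tangent"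
proof -
  have sm: "smooth_on_simplex Y" and tan: "\<And>y. y \<in> simplex_pos \<Longrightarrow> Y y \<in> tangent"
    using Y by (auto simp: vector_fields_def)
  have lin: "bounded_linear (\<lambda>y :: real ^ 'a. \<Sum>i\<in>UNIV. y $ i)"
    by (intro bounded_linear_sum bounded_linear_vec_nth)
  have "((\<lambda>t. \<Sum>i\<in>UNIV. Y (x + t *\<^sub>R v) $ i) has_vector_derivative (\<Sum>i\<in>UNIV. dir_deriv Y x v $ i)) (at 0)"
    by (rule bounded_linear.has_vector_derivative[OF lin smooth_has_dir_deriv[OF sm x v]])
  moreover have "((\<lambda>t. \<Sum>i\<in>UNIV. Y (x + t *\<^sub>R v) $ i) has_vector_derivative 0) (at 0)"
    by (rule has_vector_derivative_simplex_cong[of "\<lambda>y. 0", OF _ x v])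
      (use tan in \<open>auto simp: tangent_def\<close>)
  ultimately show ?thesis
    using vector_derivative_unique_at by (auto simp: tangent_def)
qed

section \<open>The weighted Laplacian and its pseudo-inverse\<close>

text \<open>The products \<open>A ** B\<close> and \<open>A ** C\<close> are symmetric idempotents, each of which absorbs the other;
  transposition turns one absorption law into the other, so they agree, and so do \<open>B ** A\<close> and
  \<open>C ** A\<close>.\<close>

lemma pinv_unique:
  assumes "is_pinv A B" and "is_pinv A C"
  shows "B = C"
proof -
  note b = assms(1)[unfolded is_pinv_def] and c = assms(2)[unfolded is_pinv_def]
  have "A ** B = transpose (A ** C ** (A ** B))"
    using b c by (metis matrix_mul_assoc)
  also have "\<dots> = A ** B ** (A ** C)"
    using b c by (metis matrix_transpose_mul)
  also have "\<dots> = A ** C"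
    using b c by (metis matrix_mul_assoc)
  finally have AB: "A ** B = A ** C" .
  have "B ** A = transpose (B ** A ** (C ** A))"
    using b c by (metis matrix_mul_assoc)
  also have "\<dots> = C ** A ** (B ** A)"
    using b c by (metis matrix_transpose_mul)
  also have "\<dots> = C ** A"
    using b c by (metis matrix_mul_assoc)
  finally have BA: "B ** A = C ** A" .
  show ?thesis using b c AB BA by (metis matrix_mul_assoc)
qed

lemma is_pinv_pinv: "is_pinv A B \<Longrightarrow> is_pinv A (pinv A)"
  unfolding pinv_def by (rule theI) (auto intro: pinv_unique)

lemma is_pinv_transpose: "is_pinv A B \<Longrightarrow> is_pinv (transpose A) (transpose B)"
  unfolding is_pinv_def by (metis matrix_transpose_mul matrix_mul_assoc)

lemma matrix_add_rdistrib: "(A + B) ** C = A ** C + B ** C"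
  and matrix_diff_rdistrib: "(A - B) ** C = A ** C - B ** C"
  and matrix_diff_ldistrib: "D ** (A - B) = D ** A - D ** B"
  for A B :: "real ^ 'n::finite ^ 'm::finite" and C :: "real ^ 'k::finite ^ 'n" and D :: "real ^ 'm ^ 'k"
  by (simp_all add: matrix_eq matrix_vector_mul_assoc[symmetric] matrix_vector_mult_add_rdistrib
      matrix_vector_mult_diff_rdistrib matrix_vector_mult_diff_distrib)

text \<open>The orthogonal projection onto the constant vectors, which form the kernel of the Laplacian at
  every point of the simplex.\<close>

definition mean_matrix :: "real ^ 'n::finite ^ 'n" where
  "mean_matrix = (\<chi> i j. 1 / real CARD('n))"

lemma mean_matrix_mult:
  "(mean_matrix *v \<Phi>) $ i = (\<Sum>j\<in>UNIV. \<Phi> $ j) / real CARD('n)" for \<Phi> :: "real ^ 'n::finite"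
  by (simp add: mean_matrix_def matrix_vector_mult_def sum_divide_distrib)

lemma mean_matrix_tangent: "\<Phi> \<in> tangent \<Longrightarrow> mean_matrix *v \<Phi> = 0"
  by (simp add: vec_eq_iff mean_matrix_mult tangent_def)

lemma mean_matrix_idem: "mean_matrix ** mean_matrix = (mean_matrix :: real ^ 'n::finite ^ 'n)"
  by (simp add: matrix_eq matrix_vector_mul_assoc[symmetric] vec_eq_iff mean_matrix_mult)

lemma transpose_mean_matrix: "transpose mean_matrix = mean_matrix"
  by (simp add: mean_matrix_def transpose_def vec_eq_iff)

lemma inner_symmetric_matrix:
  fixes A :: "real ^ 'n::finite ^ 'n"
  shows "transpose A = A \<Longrightarrow> (A *v x) \<bullet> y = x \<bullet> (A *v y)"
  by (metis dot_lmul_matrix vector_transpose_matrix)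

text \<open>Summation by parts on the graph: only the symmetric part of a summand matters.\<close>

lemma symmetrize_double_sum:
  fixes f g :: "'n::finite \<Rightarrow> 'n \<Rightarrow> real"
  assumes "\<And>i j. f i j + f j i = g i j + g j i"
  shows "(\<Sum>i\<in>UNIV. \<Sum>j\<in>UNIV. f i j) = (\<Sum>i\<in>UNIV. \<Sum>j\<in>UNIV. g i j)"
proof -
  have "2 * (\<Sum>i\<in>UNIV. \<Sum>j\<in>UNIV. h i j) = (\<Sum>i\<in>UNIV. \<Sum>j\<in>UNIV. h i j + h j i)"
    for h :: "'n \<Rightarrow> 'n \<Rightarrow> real"
    using sum.swap[of h UNIV UNIV] by (simp add: sum.distrib)
  from this[of f] this[of g] show ?thesis by (simp add: assms)
qed

locale weighted_graph =
  fixes E :: "('n::finite \<times> 'n) set" and \<omega> :: "'n \<Rightarrow> 'n \<Rightarrow> real"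
  assumes graph: "connected_weighted_graph E \<omega>"
begin

abbreviation L :: "real ^ 'n \<Rightarrow> real ^ 'n ^ 'n" where "L a \<equiv> Lap E \<omega> a"
abbreviation P :: "real ^ 'n \<Rightarrow> real ^ 'n ^ 'n" where "P x \<equiv> pinv (Lap E \<omega> x)"

lemma weight_sym: "\<omega> i j = \<omega> j i" and weight_nonneg: "0 \<le> \<omega> i j"
  and weight_pos: "(i, j) \<in> E \<Longrightarrow> 0 < \<omega> i j"
  and path: "(i, j) \<in> E\<^sup>*"
  using graph unfolding connected_weighted_graph_def by (metis order.refl less_imp_le)+

lemma weight_zero: "(i, j) \<notin> E \<Longrightarrow> \<omega> i j = 0"
  using graph unfolding connected_weighted_graph_def by blast

lemma sum_nbhd: "(\<Sum>j\<in>nbhd E i. \<omega> i j * f j) = (\<Sum>j\<in>UNIV. \<omega> i j * f j)"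
  by (rule sum.mono_neutral_left) (auto simp: nbhd_def weight_zero)

lemma Lap_mult: "L a *v \<Phi> = (\<chi> i. \<Sum>j\<in>UNIV. \<omega> i j * (\<theta> a i j * (\<Phi> $ i - \<Phi> $ j)))"
proof -
  have "linear (\<lambda>\<Phi> :: real ^ 'n. \<chi> i. \<Sum>j\<in>nbhd E i. \<omega> i j * \<theta> a i j * (\<Phi> $ i - \<Phi> $ j))"
    by (rule linearI)
      (simp_all add: vec_eq_iff sum.distrib[symmetric] sum_distrib_left algebra_simps)
  from fun_cong[OF matrix_vector_mul(2)[OF this], of \<Phi>] show ?thesis
    unfolding Lap_def by (simp add: mult.assoc sum_nbhd)
qed

text \<open>The Dirichlet form of the graph. Symmetry, semidefiniteness at positive weights and the pairing with \<open>edge_circ\<close>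
  are all read off from it.\<close>

lemma Lap_inner:
  "(L a *v \<Phi>) \<bullet> \<Psi> =
   (\<Sum>i\<in>UNIV. \<Sum>j\<in>UNIV. 1 / 2 * (\<omega> i j * \<theta> a i j * (\<Phi> $ i - \<Phi> $ j) * (\<Psi> $ i - \<Psi> $ j)))"
  unfolding Lap_mult inner_vec_def
  by (simp add: sum_distrib_right, rule symmetrize_double_sum)
    (simp add: weight_sym[of _ "_ :: 'n"] \<theta>_def field_simps)


lemma transpose_Lap: "transpose (L a) = L a"
proof -
  have "x \<bullet> (transpose (L a) *v y) = x \<bullet> (L a *v y)" for x y
  proof -
    have "x \<bullet> (transpose (L a) *v y) = (L a *v x) \<bullet> y"
      by (metis dot_lmul_matrix vector_transpose_matrix transpose_transpose)
    also have "\<dots> = (L a *v y) \<bullet> x"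
      unfolding Lap_inner by (intro sum.cong refl) (simp add: algebra_simps)
    finally show ?thesis by (simp add: inner_commute)
  qed
  then show ?thesis
    by (metis matrix_eq vector_eq_rdot inner_commute)
qed

lemmas Lap_symmetric = inner_symmetric_matrix[OF transpose_Lap]

lemma Lap_linear: "linear L"
proof (rule linearI)
  show "L (a + b) = L a + L b" for a b
    by (simp add: matrix_eq Lap_mult matrix_vector_mult_add_rdistrib vec_eq_iff sum.distrib[symmetric])
      (auto intro!: sum.cong simp: \<theta>_def field_simps)
  show "L (r *\<^sub>R a) = r *\<^sub>R L a" for r a
    by (simp add: matrix_eq Lap_mult scaleR_matrix_vector_assoc[symmetric] vec_eq_iff \<theta>_def
        sum_distrib_left field_simps)
qed

lemma Lap_mean: "L a ** mean_matrix = 0"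
  by (simp add: matrix_eq matrix_vector_mul_assoc[symmetric] Lap_mult mean_matrix_mult vec_eq_iff)

lemma mean_Lap: "mean_matrix ** L a = 0"
  using arg_cong[OF Lap_mean[of a], of transpose]
  by (simp add: matrix_transpose_mul transpose_Lap transpose_mean_matrix) (simp add: transpose_def vec_eq_iff)

lemma Lap_tangent: "L a *v \<Phi> \<in> tangent"
proof -
  have "mean_matrix *v (L a *v \<Phi>) = 0"
    by (simp add: matrix_vector_mul_assoc mean_Lap)
  then show ?thesis
    by (simp add: vec_eq_iff mean_matrix_mult tangent_def)
qed

text \<open>The Dirichlet form is a sum of nonnegative terms, so all of them vanish. Hence \<open>\<Phi>\<close> takes equal
  values at the ends of every edge, and connectedness does the rest.\<close>

lemma Lap_positive_kernel:
  assumes "\<rho> \<in> simplex_pos" and "(L \<rho> *v \<Phi>) \<bullet> \<Phi> = 0"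
  shows "\<Phi> $ i = \<Phi> $ j"
proof -
  have \<theta>_pos: "\<theta> \<rho> i j > 0" for i j
    using assms(1) by (simp add: \<theta>_def simplex_pos_def add_pos_pos)
  have nonneg: "0 \<le> 1 / 2 * (\<omega> i j * \<theta> \<rho> i j * (\<Phi> $ i - \<Phi> $ j) * (\<Phi> $ i - \<Phi> $ j))" for i j
    using weight_nonneg[of i j] \<theta>_pos[of i j] by (simp add: mult.assoc)
  have "(\<Sum>j\<in>UNIV. 1 / 2 * (\<omega> i j * \<theta> \<rho> i j * (\<Phi> $ i - \<Phi> $ j) * (\<Phi> $ i - \<Phi> $ j))) = 0" for i
    using assms(2) unfolding Lap_inner
    by (subst (asm) sum_nonneg_eq_0_iff) (auto intro!: sum_nonneg nonneg simp del: times_divide_eq_left)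
  then have zero: "1 / 2 * (\<omega> i j * \<theta> \<rho> i j * (\<Phi> $ i - \<Phi> $ j) * (\<Phi> $ i - \<Phi> $ j)) = 0" for i j
    using nonneg by (simp add: sum_nonneg_eq_0_iff del: times_divide_eq_left)
  have edge: "\<Phi> $ i = \<Phi> $ j" if "(i, j) \<in> E" for i j
    using zero[of i j] weight_pos[OF that] \<theta>_pos[of i j] by simp
  show ?thesis using path[of i j]
    by (induction rule: rtrancl_induct) (auto dest: edge)
qed

text \<open>Adding the projection onto the kernel makes the Laplacian invertible. An element of the kernel
  of the sum has mean zero, as the mean annihilates the range of the Laplacian, and is constant.\<close>

lemma Lap_plus_mean_invertible:
  assumes "\<rho> \<in> simplex_pos"
  shows "invertible (L \<rho> + mean_matrix)"
proof -
  have "\<Phi> = 0" if "(L \<rho> + mean_matrix) *v \<Phi> = 0" for \<Phi>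
  proof -
    have sum0: "L \<rho> *v \<Phi> + mean_matrix *v \<Phi> = 0"
      using that by (simp add: matrix_vector_mult_add_rdistrib)
    then have "mean_matrix *v (L \<rho> *v \<Phi>) + mean_matrix *v (mean_matrix *v \<Phi>) = 0"
      by (metis matrix_vector_right_distrib matrix_vector_mult_0_right)
    then have mean: "mean_matrix *v \<Phi> = 0"
      by (simp add: matrix_vector_mul_assoc mean_Lap mean_matrix_idem)
    then have "L \<rho> *v \<Phi> = 0" using sum0 by simp
    then have const: "\<Phi> $ i = \<Phi> $ j" for i j
      using Lap_positive_kernel[OF assms, of \<Phi>] by simp
    have sum: "(\<Sum>j\<in>UNIV. \<Phi> $ j) = (\<Sum>j\<in>(UNIV :: 'n set). \<Phi> $ i)" for i
      by (rule sum.cong[OF refl]) (rule const)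
    have "(mean_matrix *v \<Phi>) $ i = \<Phi> $ i" for i
      unfolding mean_matrix_mult sum[of i] by simp
    then show ?thesis using mean by (simp add: vec_eq_iff)
  qed
  then show ?thesis
    unfolding invertible_left_inverse matrix_left_invertible_ker by blast
qed

text \<open>The pseudo-inverse is \<open>matrix_inv (L \<rho> + J) - J\<close> with \<open>J\<close> the projection onto the constants: this
  matrix commutes with \<open>L \<rho>\<close>, both products being the projection \<open>1 - J\<close> onto the
  tangent space, which gives the Penrose equations.\<close>

lemma
  assumes "\<rho> \<in> simplex_pos"
  shows Lap_pinv_matrix: "L \<rho> ** P \<rho> = mat 1 - mean_matrix"
    and pinv_Lap_matrix: "P \<rho> ** L \<rho> = mat 1 - mean_matrix"
    and mean_pinv: "mean_matrix ** P \<rho> = 0"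
    and transpose_pinv: "transpose (P \<rho>) = P \<rho>"
proof -
  let ?J = "mean_matrix :: real ^ 'n ^ 'n" and ?M = "L \<rho> + mean_matrix"
  obtain N where N: "?M ** N = mat 1" "N ** ?M = mat 1"
    using Lap_plus_mean_invertible[OF assms] by (auto simp: invertible_def)
  have "?J ** ?M = ?J" "?M ** ?J = ?J"
    by (simp_all add: matrix_add_ldistrib matrix_add_rdistrib mean_Lap Lap_mean mean_matrix_idem)
  then have JN: "?J ** N = ?J" and NJ: "N ** ?J = ?J"
    using N by (metis matrix_mul_assoc matrix_mul_rid matrix_mul_lid)+
  have LN: "L \<rho> ** N = mat 1 - ?J" and NL: "N ** L \<rho> = mat 1 - ?J"
    using N JN NJ by (simp_all add: matrix_add_ldistrib matrix_add_rdistrib algebra_simps eq_diff_eq)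
  let ?Q = "N - ?J"
  have LQ: "L \<rho> ** ?Q = mat 1 - ?J" and QL: "?Q ** L \<rho> = mat 1 - ?J"
    and JQ: "?J ** ?Q = 0"
    by (simp_all add: matrix_diff_ldistrib matrix_diff_rdistrib LN NL JN NJ mean_Lap Lap_mean mean_matrix_idem)
  have absorb: "(mat 1 - ?J) ** A = A" if "?J ** A = 0" for A
    using that by (simp add: matrix_diff_rdistrib)
  have tr: "transpose (mat 1 - ?J) = mat 1 - ?J"
    by (simp add: transpose_def mat_def mean_matrix_def vec_eq_iff)
  have QLQ: "?Q ** L \<rho> ** ?Q = ?Q" unfolding QL using absorb JQ by blast
  have "L \<rho> ** ?Q ** L \<rho> = L \<rho>" unfolding LQ using absorb mean_Lap by blast
  then have pinv: "is_pinv (L \<rho>) ?Q"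
    unfolding is_pinv_def LQ QL using tr QLQ QL by simp
  have P: "P \<rho> = ?Q"
    using pinv_unique is_pinv_pinv pinv by blast
  show "L \<rho> ** P \<rho> = mat 1 - mean_matrix" "P \<rho> ** L \<rho> = mat 1 - mean_matrix" "mean_matrix ** P \<rho> = 0"
    unfolding P by (rule LQ QL JQ)+
  have "is_pinv (L \<rho>) (transpose ?Q)"
    using is_pinv_transpose[OF pinv] by (simp only: transpose_Lap)
  then show "transpose (P \<rho>) = P \<rho>"
    unfolding P using pinv by (rule pinv_unique)
qed

lemma Lap_pinv: "\<rho> \<in> simplex_pos \<Longrightarrow> \<sigma> \<in> tangent \<Longrightarrow> L \<rho> *v (P \<rho> *v \<sigma>) = \<sigma>"
  by (simp add: matrix_vector_mul_assoc Lap_pinv_matrix matrix_vector_mult_diff_rdistrib mean_matrix_tangent)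

lemma pinv_Lap_mult: "\<rho> \<in> simplex_pos \<Longrightarrow> P \<rho> *v (L \<rho> *v \<Phi>) = \<Phi> - mean_matrix *v \<Phi>"
  by (simp add: matrix_vector_mul_assoc pinv_Lap_matrix matrix_vector_mult_diff_rdistrib)

lemma pinv_symmetric: "\<rho> \<in> simplex_pos \<Longrightarrow> (P \<rho> *v x) \<bullet> y = x \<bullet> (P \<rho> *v y)"
  by (rule inner_symmetric_matrix[OF transpose_pinv])

abbreviation circ :: "real ^ 'n \<Rightarrow> real ^ 'n \<Rightarrow> real ^ 'n" where
  "circ \<Phi> \<Psi> \<equiv> edge_circ E (graph_grad \<omega> \<Phi>) (graph_grad \<omega> \<Psi>)"

lemma circ_component:
  "circ \<Phi> \<Psi> $ i = (\<Sum>j\<in>UNIV. 1 / 2 * (\<omega> i j * ((\<Phi> $ i - \<Phi> $ j) * (\<Psi> $ i - \<Psi> $ j))))"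
proof -
  have "graph_grad \<omega> \<Phi> i j * graph_grad \<omega> \<Psi> i j = \<omega> i j * ((\<Phi> $ i - \<Phi> $ j) * (\<Psi> $ i - \<Psi> $ j))" for j
    using real_sqrt_mult_self[of "\<omega> i j"] weight_nonneg[of i j] unfolding graph_grad_def
    by (metis (no_types, lifting) abs_of_nonneg mult.assoc mult.left_commute)
  then show ?thesis by (simp add: edge_circ_def sum_nbhd sum_divide_distrib[symmetric])
qed

text \<open>As \<open>\<theta>\<close> is the arithmetic mean, \<open>edge_circ\<close> represents the derivative of the Dirichlet form
  with respect to the vertex weights, in the direction \<open>c\<close>. This is where the last term of the Hessian comes from.\<close>

lemma circ_inner: "circ \<Phi> \<Psi> \<bullet> c = (L c *v \<Phi>) \<bullet> \<Psi>"
  unfolding Lap_inner unfolding inner_vec_def circ_component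
  by (simp add: sum_distrib_right, rule symmetrize_double_sum)
    (simp add: weight_sym[of _ "_ :: 'n"] \<theta>_def field_simps)

lemma circ_commute: "circ \<Phi> \<Psi> = circ \<Psi> \<Phi>"
  by (simp add: vec_eq_iff circ_component mult.commute)

lemma circ_add_left: "circ (\<Phi> + \<Phi>') \<Psi> = circ \<Phi> \<Psi> + circ \<Phi>' \<Psi>"
  by (simp add: vec_eq_iff circ_component sum.distrib[symmetric])
    (auto intro!: sum.cong simp: field_simps)

lemma circ_scaleR_left: "circ (c *\<^sub>R \<Phi>) \<Psi> = c *\<^sub>R circ \<Phi> \<Psi>"
  by (simp add: vec_eq_iff circ_component sum_distrib_left field_simps)

lemma smooth_Lap: "smooth_on_simplex L"
  using smooth_bounded_linear[OF _ smooth_ident, of L] Lap_linear by (simp add: linear_conv_bounded_linear)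

lemma smooth_Lap_field: "smooth_on_simplex X \<Longrightarrow> smooth_on_simplex (\<lambda>x. L (X x))"
  using smooth_bounded_linear[of L X] Lap_linear by (simp add: linear_conv_bounded_linear)

text \<open>The column \<open>P x *v c\<close> solves a linear system whose matrix \<open>L x + mean_matrix\<close> is invertible and
  depends smoothly on \<open>x\<close>.\<close>

lemma smooth_pinv: "smooth_on_simplex P"
proof (intro smooth_vec)
  fix i j
  define c where "c = (axis j 1 :: real ^ 'n)"
  have "smooth_on_simplex (\<lambda>x. P x *v c)"
  proof (rule smooth_linear_solve)
    show "smooth_on_simplex (\<lambda>x. L x + mean_matrix)"
      by (intro smooth_add smooth_Lap smooth_const)
    show "smooth_on_simplex (\<lambda>x. c - mean_matrix *v c)"
      by (rule smooth_const)
    fix x :: "real ^ 'n" assume x: "x \<in> simplex_pos"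
    show "det (L x + mean_matrix) \<noteq> 0"
      using Lap_plus_mean_invertible[OF x] by (simp add: invertible_det_nz)
    show "(L x + mean_matrix) *v (P x *v c) = c - mean_matrix *v c"
      by (simp add: matrix_vector_mul_assoc matrix_add_rdistrib Lap_pinv_matrix[OF x] mean_pinv[OF x]
          matrix_vector_mult_diff_rdistrib)
  qed
  from smooth_component[OF this, of i] show "smooth_on_simplex (\<lambda>x. P x $ i $ j)"
    by (simp add: c_def matrix_vector_mult_basis column_def)
qed

text \<open>The usual derivative of an inverse, \<open>- P (L a) P\<close>, as seen by tangent vectors. It comes from
  differentiating the identity \<open>L x *v (P x *v c) = c\<close> along the simplex and pairing with
  \<open>P \<rho> *v b\<close>.\<close>

lemma inner_dir_deriv_pinv:
  assumes \<rho>: "\<rho> \<in> simplex_pos" and a: "a \<in> tangent" and b: "b \<in> tangent" and c: "c \<in> tangent"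
  shows "b \<bullet> (dir_deriv P \<rho> a *v c) = - ((P \<rho> *v b) \<bullet> (L a *v (P \<rho> *v c)))"
proof -
  let ?P' = "dir_deriv P \<rho> a"
  have P': "((\<lambda>t. P (\<rho> + t *\<^sub>R a)) has_vector_derivative ?P') (at 0)"
    by (rule smooth_has_dir_deriv[OF smooth_pinv \<rho> a])
  have L': "((\<lambda>t. L (\<rho> + t *\<^sub>R a)) has_vector_derivative L a) (at 0)"
    by (rule bounded_linear.has_vector_derivative[of L])
      (auto simp: linear_conv_bounded_linear[symmetric] Lap_linear has_vector_derivative_def
        intro!: derivative_eq_intros)
  have Pc: "((\<lambda>t. P (\<rho> + t *\<^sub>R a) *v c) has_vector_derivative ?P' *v c) (at 0)"
    using bounded_bilinear.has_vector_derivative[OF bounded_bilinear_matrix_vector_mult P'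
        has_vector_derivative_const[of c]] by simp
  have "((\<lambda>t. L (\<rho> + t *\<^sub>R a) *v (P (\<rho> + t *\<^sub>R a) *v c)) has_vector_derivative
      L \<rho> *v (?P' *v c) + L a *v (P \<rho> *v c)) (at 0)"
    using bounded_bilinear.has_vector_derivative[OF bounded_bilinear_matrix_vector_mult L' Pc] by simp
  moreover have "((\<lambda>t. L (\<rho> + t *\<^sub>R a) *v (P (\<rho> + t *\<^sub>R a) *v c)) has_vector_derivative 0) (at 0)"
    by (rule has_vector_derivative_simplex_cong[of "\<lambda>x. c", OF _ \<rho> a]) (simp_all add: Lap_pinv c)
  ultimately have "L \<rho> *v (?P' *v c) + L a *v (P \<rho> *v c) = 0"
    by (rule vector_derivative_unique_at)
  then have "L \<rho> *v (?P' *v c) = - (L a *v (P \<rho> *v c))"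
    by (simp add: add_eq_0_iff2)
  moreover have "b \<bullet> (?P' *v c) = (P \<rho> *v b) \<bullet> (L \<rho> *v (?P' *v c))"
    using Lap_symmetric[of \<rho> "P \<rho> *v b"] Lap_pinv[OF \<rho> b] by simp
  ultimately show ?thesis by simp
qed

end

section \<open>The Levi-Civita connection\<close>

lemma dir_deriv_const: "dir_deriv (\<lambda>_. c) x v = 0"
  by (rule dir_derivI) (rule has_vector_derivative_const)

lemma const_vector_field: "\<sigma> \<in> tangent \<Longrightarrow> (\<lambda>_. \<sigma>) \<in> vector_fields"
  by (simp add: vector_fields_def smooth_const)

lemma vector_fields_smooth: "X \<in> vector_fields \<Longrightarrow> smooth_on_simplex X"
  and vector_fields_tangent: "X \<in> vector_fields \<Longrightarrow> x \<in> simplex_pos \<Longrightarrow> X x \<in> tangent"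
  by (simp_all add: vector_fields_def)

lemma dir_deriv_add:
  assumes "smooth_on_simplex f" "smooth_on_simplex g" "x \<in> simplex_pos" "v \<in> tangent"
  shows "dir_deriv (\<lambda>x. f x + g x) x v = dir_deriv f x v + dir_deriv g x v"
  by (rule dir_derivI, rule has_vector_derivative_add) (intro smooth_has_dir_deriv assms)+

lemma dir_deriv_scaleR:
  assumes "smooth_on_simplex f" "smooth_on_simplex g" "x \<in> simplex_pos" "v \<in> tangent"
  shows "dir_deriv (\<lambda>x. f x *\<^sub>R g x) x v = dir_deriv f x v *\<^sub>R g x + f x *\<^sub>R dir_deriv g x v"
  using bounded_bilinear.has_vector_derivative[OF bounded_bilinear_scaleR
      smooth_has_dir_deriv[OF assms(1,3,4)] smooth_has_dir_deriv[OF assms(2,3,4)]]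
  by (intro dir_derivI) (simp add: add.commute)

context weighted_graph
begin

abbreviation g :: "'n metric" where "g \<equiv> g_W E \<omega>"

lemma g_commute: "\<rho> \<in> simplex_pos \<Longrightarrow> g \<rho> b c = g \<rho> c b"
  unfolding g_W_def using pinv_symmetric[of \<rho> b c] by (simp add: inner_commute)

text \<open>The difference between the Levi-Civita connection and the flat connection of the simplex. The
  formula is the solution of the Koszul identity for constant fields, read through the metric:
  pairing with \<open>P \<rho> *v c\<close> gives half the signed sum of the three derivatives of the metric, as
  \<open>christoffel_pairing\<close> shows.\<close>

definition christoffel :: "real ^ 'n \<Rightarrow> real ^ 'n \<Rightarrow> real ^ 'n \<Rightarrow> real ^ 'n" where
  "christoffel \<rho> a b = (1 / 2) *\<^sub>R
     (L \<rho> *v circ (P \<rho> *v a) (P \<rho> *v b) - L a *v (P \<rho> *v b) - L b *v (P \<rho> *v a))"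

lemma christoffel_tangent: "christoffel \<rho> a b \<in> tangent"
  unfolding christoffel_def by (intro scaleR_tangent diff_tangent Lap_tangent)

lemma christoffel_commute: "christoffel \<rho> a b = christoffel \<rho> b a"
  unfolding christoffel_def by (simp add: circ_commute[of "P \<rho> *v a"] algebra_simps)

lemma christoffel_add_left: "christoffel \<rho> (a + a') b = christoffel \<rho> a b + christoffel \<rho> a' b"
  unfolding christoffel_def
  by (simp add: circ_add_left matrix_vector_right_distrib matrix_vector_mult_add_rdistrib
      linear_add[OF Lap_linear] algebra_simps)

lemma christoffel_scaleR_left: "christoffel \<rho> (c *\<^sub>R a) b = c *\<^sub>R christoffel \<rho> a b"
  unfolding christoffel_def
  by (simp add: circ_scaleR_left matrix_vector_mult_scaleR scaleR_matrix_vector_assoc[symmetric]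
      linear_cmul[OF Lap_linear] algebra_simps)

lemma christoffel_add_right: "christoffel \<rho> a (b + b') = christoffel \<rho> a b + christoffel \<rho> a b'"
  by (metis christoffel_add_left christoffel_commute)

lemma christoffel_scaleR_right: "christoffel \<rho> a (c *\<^sub>R b) = c *\<^sub>R christoffel \<rho> a b"
  by (metis christoffel_scaleR_left christoffel_commute)

lemma smooth_christoffel:
  assumes X: "smooth_on_simplex X" and Y: "smooth_on_simplex Y"
  shows "smooth_on_simplex (\<lambda>x. christoffel x (X x) (Y x))"
proof -
  have PX: "smooth_on_simplex (\<lambda>x. P x *v X x)" and PY: "smooth_on_simplex (\<lambda>x. P x *v Y x)"
    by (intro smooth_matrix_vector_mult smooth_pinv X Y)+
  have circ: "smooth_on_simplex (\<lambda>x. circ (P x *v X x) (P x *v Y x))"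
    by (rule smooth_vec, unfold circ_component)
      (intro smooth_sum smooth_mult smooth_const smooth_diff smooth_component PX PY)
  show ?thesis
    unfolding christoffel_def
    by (rule smooth_scaleR[OF smooth_const smooth_diff[OF smooth_diff]])
      (intro smooth_matrix_vector_mult smooth_Lap_field smooth_Lap circ PX PY X Y)+
qed

lemma christoffel_pairing:
  assumes \<rho>: "\<rho> \<in> simplex_pos" and c: "c \<in> tangent"
  shows "christoffel \<rho> a b \<bullet> (P \<rho> *v c) = 1 / 2 *
    ((L c *v (P \<rho> *v a)) \<bullet> (P \<rho> *v b) - (L a *v (P \<rho> *v b)) \<bullet> (P \<rho> *v c)
      - (L b *v (P \<rho> *v a)) \<bullet> (P \<rho> *v c))"
proof -
  have "(L \<rho> *v circ (P \<rho> *v a) (P \<rho> *v b)) \<bullet> (P \<rho> *v c) = (L c *v (P \<rho> *v a)) \<bullet> (P \<rho> *v b)"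
    using Lap_symmetric[of \<rho> "circ (P \<rho> *v a) (P \<rho> *v b)" "P \<rho> *v c"] Lap_pinv[OF \<rho> c]
      circ_inner[of "P \<rho> *v a" "P \<rho> *v b" c] by simp
  then show ?thesis by (simp add: christoffel_def inner_diff_left)
qed

text \<open>When the two signed sums of \<open>christoffel_pairing\<close> are added, the terms with \<open>L b\<close> and \<open>L c\<close> cancel and those with
  \<open>L a\<close> add up to the derivative of the metric along \<open>a\<close>.\<close>

lemma christoffel_compatible:
  assumes \<rho>: "\<rho> \<in> simplex_pos" and b: "b \<in> tangent" and c: "c \<in> tangent"
  shows "christoffel \<rho> a b \<bullet> (P \<rho> *v c) + christoffel \<rho> a c \<bullet> (P \<rho> *v b) = - ((P \<rho> *v b) \<bullet> (L a *v (P \<rho> *v c)))"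
proof -
  have "(L x *v y) \<bullet> z = (L x *v z) \<bullet> y" for x y z
    using Lap_symmetric[of x y z] by (simp add: inner_commute)
  then show ?thesis
    unfolding christoffel_pairing[OF \<rho> c] christoffel_pairing[OF \<rho> b]
    using inner_commute[of "P \<rho> *v b" "L a *v (P \<rho> *v c)"] by (simp add: algebra_simps)
qed

lemma dir_deriv_metric:
  assumes Y: "Y \<in> vector_fields" and Z: "Z \<in> vector_fields" and \<rho>: "\<rho> \<in> simplex_pos" and a: "a \<in> tangent"
  shows "dir_deriv (\<lambda>x. g x (Y x) (Z x)) \<rho> a =
    dir_deriv Y \<rho> a \<bullet> (P \<rho> *v Z \<rho>) + Y \<rho> \<bullet> (P \<rho> *v dir_deriv Z \<rho> a)
      - (P \<rho> *v Y \<rho>) \<bullet> (L a *v (P \<rho> *v Z \<rho>))"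
proof -
  note d = smooth_has_dir_deriv[OF _ \<rho> a]
  have "((\<lambda>t. P (\<rho> + t *\<^sub>R a) *v Z (\<rho> + t *\<^sub>R a)) has_vector_derivative
      P \<rho> *v dir_deriv Z \<rho> a + dir_deriv P \<rho> a *v Z \<rho>) (at 0)"
    using bounded_bilinear.has_vector_derivative[OF bounded_bilinear_matrix_vector_mult
        d[OF smooth_pinv] d[OF vector_fields_smooth[OF Z]]] by simp
  from bounded_bilinear.has_vector_derivative[OF bounded_bilinear_inner
      d[OF vector_fields_smooth[OF Y]] this]
  have "dir_deriv (\<lambda>x. g x (Y x) (Z x)) \<rho> a =
    Y \<rho> \<bullet> (P \<rho> *v dir_deriv Z \<rho> a + dir_deriv P \<rho> a *v Z \<rho>) + dir_deriv Y \<rho> a \<bullet> (P \<rho> *v Z \<rho>)"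
    unfolding g_W_def by (intro dir_derivI) simp
  then show ?thesis
    using inner_dir_deriv_pinv[OF \<rho> a vector_fields_tangent[OF Y \<rho>] vector_fields_tangent[OF Z \<rho>]]
    by (simp add: inner_add_right)
qed

text \<open>A concrete Levi-Civita connection. It serves only to show that one exists, so that the choice in
  \<open>levi_civita\<close> does pick a torsion-free metric connection.\<close>

definition connection :: "'n field \<Rightarrow> 'n field \<Rightarrow> 'n field" where
  "connection X Y \<rho> = dir_deriv Y \<rho> (X \<rho>) + christoffel \<rho> (X \<rho>) (Y \<rho>)"

lemma connection_affine: "affine_connection connection"
proof -
  have "connection X Y \<in> vector_fields" if X: "X \<in> vector_fields" and Y: "Y \<in> vector_fields" for X Y
  proof -
    have "smooth_on_simplex (\<lambda>x. dir_deriv Y x (X x) + christoffel x (X x) (Y x))"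
      by (rule smooth_add[OF smooth_dir_deriv_field[OF vector_fields_smooth[OF Y] X]
            smooth_christoffel[OF vector_fields_smooth[OF X] vector_fields_smooth[OF Y]]])
    moreover have "dir_deriv Y x (X x) + christoffel x (X x) (Y x) \<in> tangent" if "x \<in> simplex_pos" for x
      by (rule add_tangent[OF dir_deriv_tangent[OF Y that vector_fields_tangent[OF X that]] christoffel_tangent])
    ultimately show ?thesis by (simp add: vector_fields_def connection_def[abs_def])
  qed
  then show ?thesis
    unfolding affine_connection_def
    by (intro conjI ballI allI impI)
      (simp_all add: connection_def dir_deriv_add_direction dir_deriv_scaleR_direction
        dir_deriv_add dir_deriv_scaleR vector_fields_smooth vector_fields_tangent
        christoffel_add_left christoffel_scaleR_left christoffel_add_right christoffel_scaleR_right
        scaleR_add_right)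
qed

lemma connection_torsion_free: "torsion_free connection"
  unfolding torsion_free_def connection_def lie_bracket_def
proof (intro ballI)
  fix X Y :: "'n field" and \<rho> :: "real ^ 'n"
  show "dir_deriv Y \<rho> (X \<rho>) + christoffel \<rho> (X \<rho>) (Y \<rho>) -
      (dir_deriv X \<rho> (Y \<rho>) + christoffel \<rho> (Y \<rho>) (X \<rho>)) = dir_deriv Y \<rho> (X \<rho>) - dir_deriv X \<rho> (Y \<rho>)"
    by (subst christoffel_commute) simp
qed

lemma connection_metric_compatible: "metric_compatible g connection"
  unfolding metric_compatible_def
proof (intro ballI)
  fix X Y Z :: "'n field" and \<rho> :: "real ^ 'n"
  assume X: "X \<in> vector_fields" and Y: "Y \<in> vector_fields" and Z: "Z \<in> vector_fields" and \<rho>: "\<rho> \<in> simplex_pos"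
  have sym: "Y \<rho> \<bullet> (P \<rho> *v christoffel \<rho> (X \<rho>) (Z \<rho>)) = christoffel \<rho> (X \<rho>) (Z \<rho>) \<bullet> (P \<rho> *v Y \<rho>)"
    by (metis pinv_symmetric[OF \<rho>] inner_commute)
  have "g \<rho> (connection X Y \<rho>) (Z \<rho>) + g \<rho> (Y \<rho>) (connection X Z \<rho>) =
      dir_deriv Y \<rho> (X \<rho>) \<bullet> (P \<rho> *v Z \<rho>) + Y \<rho> \<bullet> (P \<rho> *v dir_deriv Z \<rho> (X \<rho>))
      + (christoffel \<rho> (X \<rho>) (Y \<rho>) \<bullet> (P \<rho> *v Z \<rho>) + christoffel \<rho> (X \<rho>) (Z \<rho>) \<bullet> (P \<rho> *v Y \<rho>))"
    unfolding g_W_def connection_def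
    by (simp add: inner_add_left inner_add_right matrix_vector_right_distrib sym)
  then show "dir_deriv (\<lambda>x. g x (Y x) (Z x)) \<rho> (X \<rho>) =
      g \<rho> (connection X Y \<rho>) (Z \<rho>) + g \<rho> (Y \<rho>) (connection X Z \<rho>)"
    using christoffel_compatible[OF \<rho> vector_fields_tangent[OF Y \<rho>] vector_fields_tangent[OF Z \<rho>]]
    unfolding dir_deriv_metric[OF Y Z \<rho> vector_fields_tangent[OF X \<rho>]] by simp
qed

lemma
  shows levi_civita_torsion_free: "torsion_free (levi_civita g)"
    and levi_civita_metric_compatible: "metric_compatible g (levi_civita g)"
proof -
  have "\<exists>D. affine_connection D \<and> torsion_free D \<and> metric_compatible g D"
    using connection_affine connection_torsion_free connection_metric_compatible by blast
  from someI_ex[OF this] show "torsion_free (levi_civita g)" "metric_compatible g (levi_civita g)"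
    unfolding levi_civita_def by blast+
qed

text \<open>Constant fields have vanishing Lie brackets, so torsion-freeness makes the covariant derivatives
  of constant fields symmetric. Metric compatibility for the three cyclic choices of the direction
  then gives three linear equations that determine them. As the
  argument starts from the characteristic properties, it applies to whichever connection the choice
  operator returns.\<close>

lemma koszul:
  assumes \<rho>: "\<rho> \<in> simplex_pos" and a: "a \<in> tangent" and b: "b \<in> tangent" and c: "c \<in> tangent"
  shows "2 * g \<rho> (levi_civita g (\<lambda>_. a) (\<lambda>_. b) \<rho>) c =
    (L c *v (P \<rho> *v a)) \<bullet> (P \<rho> *v b) - (L a *v (P \<rho> *v b)) \<bullet> (P \<rho> *v c)
      - (L b *v (P \<rho> *v a)) \<bullet> (P \<rho> *v c)"
proof -
  let ?D = "\<lambda>u v. levi_civita g (\<lambda>_. u) (\<lambda>_. v) \<rho>"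
  have sym: "?D u v = ?D v u" if "u \<in> tangent" "v \<in> tangent" for u v
  proof -
    have "?D u v - ?D v u = lie_bracket (\<lambda>_. u) (\<lambda>_. v) \<rho>"
      by (rule levi_civita_torsion_free[unfolded torsion_free_def,
            THEN bspec, THEN bspec, THEN bspec, OF const_vector_field[OF that(1)]
            const_vector_field[OF that(2)] \<rho>])
    then show ?thesis by (simp add: lie_bracket_def dir_deriv_const)
  qed
  have met: "- ((L u *v (P \<rho> *v v)) \<bullet> (P \<rho> *v w)) = g \<rho> (?D u v) w + g \<rho> v (?D u w)"
    if "u \<in> tangent" "v \<in> tangent" "w \<in> tangent" for u v w
  proof -
    have "dir_deriv (\<lambda>x. g x v w) \<rho> u = g \<rho> (?D u v) w + g \<rho> v (?D u w)"
      by (rule levi_civita_metric_compatible[unfolded metric_compatible_def,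
            THEN bspec, THEN bspec, THEN bspec, THEN bspec, OF const_vector_field[OF that(1)]
            const_vector_field[OF that(2)] const_vector_field[OF that(3)] \<rho>])
    moreover have "dir_deriv (\<lambda>x. g x v w) \<rho> u = - ((P \<rho> *v v) \<bullet> (L u *v (P \<rho> *v w)))"
      using dir_deriv_metric[OF const_vector_field[OF that(2)] const_vector_field[OF that(3)] \<rho> that(1)]
      by (simp add: dir_deriv_const)
    ultimately show ?thesis by (simp add: Lap_symmetric)
  qed
  have "- ((L a *v (P \<rho> *v b)) \<bullet> (P \<rho> *v c)) = g \<rho> (?D a b) c + g \<rho> (?D a c) b"
    using met[OF a b c] unfolding g_commute[OF \<rho>, of b "?D a c"] .
  moreover have "- ((L b *v (P \<rho> *v a)) \<bullet> (P \<rho> *v c)) = g \<rho> (?D a b) c + g \<rho> (?D b c) a"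
    using met[OF b a c] unfolding sym[OF b a] g_commute[OF \<rho>, of a "?D b c"] .
  moreover have "- ((L c *v (P \<rho> *v a)) \<bullet> (P \<rho> *v b)) = g \<rho> (?D a c) b + g \<rho> (?D b c) a"
    using met[OF c a b] unfolding sym[OF c a] sym[OF c b] g_commute[OF \<rho>, of a "?D b c"] .
  ultimately show ?thesis by linarith
qed

end

section \<open>The Hessian\<close>

lemma linear_axis_expansion:
  fixes f :: "real ^ 'n::finite \<Rightarrow> 'b::real_vector"
  assumes "linear f"
  shows "f v = (\<Sum>i\<in>UNIV. (v $ i) *\<^sub>R f (axis i 1))"
proof -
  have "v = (\<Sum>i\<in>UNIV. (v $ i) *\<^sub>R axis i 1)"
    using basis_expansion[of v] by (simp add: scalar_mult_eq_scaleR)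
  from arg_cong[OF this, of f] show ?thesis
    by (simp add: linear_sum[OF assms] linear_cmul[OF assms])
qed

lemma eucl_grad_inner:
  assumes "f differentiable at x"
  shows "eucl_grad f x \<bullet> v = frechet_derivative f (at x) v"
  using linear_axis_expansion[OF linear_frechet_derivative[OF assms], of v]
  by (simp add: eucl_grad_def inner_vec_def dir_deriv_eq_frechet[OF assms] mult.commute)

text \<open>Linearity in \<open>w\<close> is that of a derivative. Linearity in \<open>v\<close> at the single point \<open>x\<close> then
  follows from the symmetry of second derivatives.\<close>

lemma eucl_hess_bilinear:
  fixes f :: "real ^ 'n::finite \<Rightarrow> real"
  assumes U: "open U" "x \<in> U" and f: "Cinf_on f U"
  shows "v \<bullet> (eucl_hess f x *v w) =
    frechet_derivative (\<lambda>y. frechet_derivative f (at y) v) (at x) w"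
proof -
  define B where "B v w = frechet_derivative (\<lambda>y. frechet_derivative f (at y) v) (at x) w" for v w
  have sym: "B v w = B w v" for v w
    unfolding B_def by (rule mixed_derivatives_commute[OF U f])
  have lin: "linear (B v)" for v
    unfolding B_def[abs_def]
    by (rule linear_frechet_derivative[OF Cinf_on_differentiable[OF Cinf_on_derivative[OF f] U(2)]])
  have entry: "eucl_hess f x $ i $ j = B (axis i 1) (axis j 1)" for i j
  proof -
    have "((\<lambda>y. dir_deriv f y (axis j 1)) has_derivative
        frechet_derivative (\<lambda>y. frechet_derivative f (at y) (axis j 1)) (at x)) (at x)"
      by (rule has_derivative_transform_within_open
          [OF Cinf_on_has_derivative[OF Cinf_on_derivative[OF f] U(2)] U])
        (simp add: dir_deriv_eq_frechet[OF Cinf_on_differentiable[OF f]])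
    note d = this
    have "dir_deriv (\<lambda>y. dir_deriv f y (axis j 1)) x (axis i 1) = B (axis j 1) (axis i 1)"
      unfolding B_def dir_deriv_eq_frechet[OF differentiableI[OF d]] frechet_derivative_at[OF d, symmetric] ..
    then show ?thesis by (simp add: eucl_hess_def sym[of "axis j 1"])
  qed
  have "B v w = (\<Sum>i\<in>UNIV. v $ i * B (axis i 1) w)"
    using linear_axis_expansion[OF lin, of w v] by (simp only: sym[of _ w] real_scaleR_def)
  also have "\<dots> = (\<Sum>i\<in>UNIV. v $ i * (\<Sum>j\<in>UNIV. w $ j * B (axis i 1) (axis j 1)))"
    using linear_axis_expansion[OF lin, of _ w] by (simp only: real_scaleR_def)
  finally have "B v w = (\<Sum>i\<in>UNIV. v $ i * (\<Sum>j\<in>UNIV. w $ j * B (axis i 1) (axis j 1)))" .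
  then show ?thesis
    by (simp add: inner_vec_def matrix_vector_mult_def entry B_def mult.commute)
qed

context weighted_graph
begin

text \<open>The Laplacian inverts the metric: \<open>g x (L x *v d) \<sigma> = d \<bullet> \<sigma>\<close>. For uniqueness, a tangent vector \<open>w\<close>
  orthogonal to all tangent vectors is tested against \<open>L x *v w\<close>, which gives \<open>w \<bullet> w = 0\<close>.\<close>

lemma riem_grad_eq:
  assumes x: "x \<in> simplex_pos" and d: "\<And>\<sigma>. \<sigma> \<in> tangent \<Longrightarrow> dir_deriv f x \<sigma> = d \<bullet> \<sigma>"
  shows "riem_grad g f x = L x *v d"
  unfolding riem_grad_def
proof (rule the_equality)
  have eq: "g x (L x *v d) \<sigma> = dir_deriv f x \<sigma>" if "\<sigma> \<in> tangent" for \<sigma>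
    by (simp add: g_W_def Lap_symmetric Lap_pinv[OF x that] d[OF that])
  then show "L x *v d \<in> tangent \<and> (\<forall>\<sigma>\<in>tangent. g x (L x *v d) \<sigma> = dir_deriv f x \<sigma>)"
    using Lap_tangent by blast
  fix v assume v: "v \<in> tangent \<and> (\<forall>\<sigma>\<in>tangent. g x v \<sigma> = dir_deriv f x \<sigma>)"
  define w where "w = v - L x *v d"
  have w: "w \<in> tangent" unfolding w_def using v Lap_tangent diff_tangent by blast
  have "g x w \<sigma> = 0" if "\<sigma> \<in> tangent" for \<sigma>
    using v eq[OF that] that by (simp add: w_def g_W_def inner_diff_left)
  from this[OF Lap_tangent[of x w]] have "w \<bullet> w = 0"
    by (simp add: g_W_def pinv_Lap_mult[OF x] mean_matrix_tangent[OF w])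
  then show "v = L x *v d" by (simp add: w_def)
qed

text \<open>Metric compatibility for the fields \<open>\<sigma>\<^sub>1\<close> and the gradient, in the direction \<open>\<sigma>\<^sub>2\<close>, moves the
  covariant derivative from the gradient to \<open>\<sigma>\<^sub>1\<close>. The function being differentiated,
  \<open>g x \<sigma>\<^sub>1 (riem_grad g F x)\<close>, is the derivative of \<open>F\<close> along \<open>\<sigma>\<^sub>1\<close>, so the left-hand side is
  the Euclidean second derivative; the correction is the Koszul formula with the gradient as third
  vector, in which the pseudo-inverse turns the gradient back into the Euclidean one, up to a constant vector.\<close>

lemma hessian_formula:
  assumes U: "open U" "simplex_pos \<subseteq> U" and F': "Cinf_on F' U"
    and eq: "\<And>x. x \<in> simplex_pos \<Longrightarrow> F' x = F x"
    and \<rho>: "\<rho> \<in> simplex_pos" and s1: "\<sigma>\<^sub>1 \<in> tangent" and s2: "\<sigma>\<^sub>2 \<in> tangent"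
  shows "riem_hess g F \<rho> \<sigma>\<^sub>1 \<sigma>\<^sub>2 = \<sigma>\<^sub>1 \<bullet> (eucl_hess F' \<rho> *v \<sigma>\<^sub>2) +
    1 / 2 * (eucl_grad F' \<rho> \<bullet> (L \<sigma>\<^sub>1 *v (P \<rho> *v \<sigma>\<^sub>2)) + eucl_grad F' \<rho> \<bullet> (L \<sigma>\<^sub>2 *v (P \<rho> *v \<sigma>\<^sub>1)) -
      eucl_grad F' \<rho> \<bullet> (L \<rho> *v circ (P \<rho> *v \<sigma>\<^sub>1) (P \<rho> *v \<sigma>\<^sub>2)))"
proof -
  let ?D = "levi_civita g" and ?G = "riem_grad g F" and ?d = "eucl_grad F'"
  have diff: "F' differentiable at x" if "x \<in> simplex_pos" for x
    using Cinf_on_differentiable[OF F'] that U(2) by blast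
  have dF: "dir_deriv F x \<sigma> = ?d x \<bullet> \<sigma>" if x: "x \<in> simplex_pos" and \<sigma>: "\<sigma> \<in> tangent" for x \<sigma>
    unfolding eucl_grad_inner[OF diff[OF x]]
    by (rule dir_derivI[OF has_vector_derivative_of_extension[OF U(1) _ diff[OF x] _ x \<sigma>]])
      (use x U(2) eq in auto)
  have G: "?G x = L x *v ?d x" if "x \<in> simplex_pos" for x
    by (rule riem_grad_eq[OF that dF[OF that]])
  have "smooth_on_simplex ?d"
  proof (rule smooth_vec, rule smooth_cong)
    fix i
    show "smooth_on_simplex (\<lambda>x. frechet_derivative F' (at x) (axis i 1))"
      by (rule Cinf_on_smooth[OF U Cinf_on_derivative[OF F']])
    show "frechet_derivative F' (at x) (axis i 1) = ?d x $ i" if "x \<in> simplex_pos" for x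
      by (simp add: eucl_grad_def dir_deriv_eq_frechet[OF diff[OF that]])
  qed
  then have "smooth_on_simplex (\<lambda>x. L x *v ?d x)"
    by (intro smooth_matrix_vector_mult smooth_Lap)
  then have "smooth_on_simplex ?G"
    by (rule smooth_cong[rotated]) (simp add: G)
  then have Gfield: "?G \<in> vector_fields"
    by (simp add: vector_fields_def G Lap_tangent)

  \<comment> \<open>The Euclidean gradient comes back from the Riemannian one only up to its mean. The mean is
    harmless, as it is only ever paired with tangent vectors.\<close>
  have pair: "(P x *v ?G x) = ?d x - mean_matrix *v ?d x" if "x \<in> simplex_pos" for x
    using that by (simp add: G pinv_Lap_mult)
  have tan: "\<sigma> \<bullet> (v - mean_matrix *v v) = v \<bullet> \<sigma>" if "\<sigma> \<in> tangent" for \<sigma> v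
    using inner_symmetric_matrix[OF transpose_mean_matrix, of \<sigma> v] mean_matrix_tangent[OF that]
    by (simp add: inner_diff_right inner_commute)

  have "dir_deriv (\<lambda>x. g x \<sigma>\<^sub>1 (?G x)) \<rho> \<sigma>\<^sub>2 = g \<rho> (?D (\<lambda>_. \<sigma>\<^sub>2) (\<lambda>_. \<sigma>\<^sub>1) \<rho>) (?G \<rho>) + riem_hess g F \<rho> \<sigma>\<^sub>1 \<sigma>\<^sub>2"
    unfolding riem_hess_def
    by (rule levi_civita_metric_compatible[unfolded metric_compatible_def,
          THEN bspec, THEN bspec, THEN bspec, THEN bspec, OF const_vector_field[OF s2]
          const_vector_field[OF s1] Gfield \<rho>])
  moreover have "dir_deriv (\<lambda>x. g x \<sigma>\<^sub>1 (?G x)) \<rho> \<sigma>\<^sub>2 = \<sigma>\<^sub>1 \<bullet> (eucl_hess F' \<rho> *v \<sigma>\<^sub>2)"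
  proof -
    have \<rho>U: "\<rho> \<in> U" using \<rho> U(2) by blast
    show ?thesis
      unfolding eucl_hess_bilinear[OF U(1) \<rho>U F']
    proof (rule dir_derivI[OF has_vector_derivative_of_extension[OF U(1) \<rho>U _ _ \<rho> s2]])
      show "(\<lambda>y. frechet_derivative F' (at y) \<sigma>\<^sub>1) differentiable at \<rho>"
        by (rule Cinf_on_differentiable[OF Cinf_on_derivative[OF F'] \<rho>U])
      show "\<forall>y\<in>U \<inter> simplex_pos. frechet_derivative F' (at y) \<sigma>\<^sub>1 = g y \<sigma>\<^sub>1 (?G y)"
        by (simp add: g_W_def pair tan[OF s1] eucl_grad_inner[OF diff])
    qed
  qed
  moreover have "2 * g \<rho> (?D (\<lambda>_. \<sigma>\<^sub>2) (\<lambda>_. \<sigma>\<^sub>1) \<rho>) (?G \<rho>) =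
      ?d \<rho> \<bullet> (L \<rho> *v circ (P \<rho> *v \<sigma>\<^sub>1) (P \<rho> *v \<sigma>\<^sub>2)) - ?d \<rho> \<bullet> (L \<sigma>\<^sub>2 *v (P \<rho> *v \<sigma>\<^sub>1))
        - ?d \<rho> \<bullet> (L \<sigma>\<^sub>1 *v (P \<rho> *v \<sigma>\<^sub>2))"
  proof -
    have "(L (?G \<rho>) *v (P \<rho> *v \<sigma>\<^sub>2)) \<bullet> (P \<rho> *v \<sigma>\<^sub>1) = ?d \<rho> \<bullet> (L \<rho> *v circ (P \<rho> *v \<sigma>\<^sub>1) (P \<rho> *v \<sigma>\<^sub>2))"
      by (metis circ_inner circ_commute G[OF \<rho>] Lap_symmetric inner_commute)
    then show ?thesis
      unfolding koszul[OF \<rho> s2 s1 vector_fields_tangent[OF Gfield \<rho>]] pair[OF \<rho>] tan[OF Lap_tangent]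
      by simp
  qed
  ultimately show ?thesis by argo
qed

end

theorem proposition9:
  fixes E :: "('n::finite \<times> 'n) set" and \<omega> :: "'n \<Rightarrow> 'n \<Rightarrow> real"
    and F F' :: "real ^ 'n \<Rightarrow> real" and U :: "(real ^ 'n) set"
    and \<rho> \<sigma>\<^sub>1 \<sigma>\<^sub>2 :: "real ^ 'n"
  assumes "connected_weighted_graph E \<omega>"
    and "smooth_on_simplex F"
    and "open U" and "simplex_pos \<subseteq> U" and "Cinf_on F' U"
    and "\<And>x. x \<in> simplex_pos \<Longrightarrow> F' x = F x"
    and "\<rho> \<in> simplex_pos" and "\<sigma>\<^sub>1 \<in> tangent" and "\<sigma>\<^sub>2 \<in> tangent"
  shows "Hess_W E \<omega> F \<rho> \<sigma>\<^sub>1 \<sigma>\<^sub>2 =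
    \<sigma>\<^sub>1 \<bullet> (eucl_hess F' \<rho> *v \<sigma>\<^sub>2) +
    1 / 2 *
      (eucl_grad F' \<rho> \<bullet> (Lap E \<omega> \<sigma>\<^sub>1 *v (pinv (Lap E \<omega> \<rho>) *v \<sigma>\<^sub>2)) +
       eucl_grad F' \<rho> \<bullet> (Lap E \<omega> \<sigma>\<^sub>2 *v (pinv (Lap E \<omega> \<rho>) *v \<sigma>\<^sub>1)) -
       eucl_grad F' \<rho> \<bullet>
         (Lap E \<omega> \<rho> *v
           edge_circ E (graph_grad \<omega> (pinv (Lap E \<omega> \<rho>) *v \<sigma>\<^sub>1))
                       (graph_grad \<omega> (pinv (Lap E \<omega> \<rho>) *v \<sigma>\<^sub>2))))"
proof -
  interpret weighted_graph E \<omega> by unfold_locales (rule assms(1))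
  show ?thesis
    unfolding Hess_W_def using assms(3-) by (rule hessian_formula)
qed

end
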